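(* Let $\Delta\subset M_{\mathbb{R}}$ be a reflexive polytope with dual $\Delta^\vee\subset N_{\mathbb{R}}$, let $\Phi:M_{\mathbb{R}}\to\mathbb{R}$ be a convex function such that $\left|\sup_{n\in\Delta^\vee}\langle m,n\rangle-\Phi(m)\right|$ is bounded on $M_{\mathbb{R}}$, and let $\Psi:N_{\mathbb{R}}\to\mathbb{R}$, $\Psi(n)=\sup_{m\in\partial\Delta}\left(\langle m,n\rangle-\Phi(m)\right)$. Assume that the (a priori weak) Hessian metrics induced by $\Phi$ and $\Psi$ are smooth Hessian metrics, and that $\partial^c\Phi:\partial\Delta\to\partial\Delta^\vee$ is (single valued and) a homeomorphism. Let $(X,\nabla,g)$ be the Hessian manifold given by the integral affine structure on (a subset of) $\partial\Delta$ induced by $\Phi$ together with the Hessian metric $g$ induced by $\Phi$, and let $(X,\nabla',g)$ be its dual. Then $(X,\nabla')$ is affinely isomorphic to the integral affine structure on (a subset of) $\partial\Delta^\vee$ induced by $\Psi$, and under this identification $g$ coincides with the Hessian metric induced by $\Psi$.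
   Context: Affine and Hessian manifolds. An affine structure on a smooth manifold is a flat torsion-free connection on its tangent bundle, equivalently an atlas with affine transition functions (its charts are affine coordinates). An affine isomorphism is a diffeomorphism carrying one connection to the other. A Hessian metric on $(X,\nabla)$ is a Riemannian metric $g$ that locally, in affine coordinates, equals $\nabla d\phi=\sum_{j,k}\frac{\partial^2\phi}{\partial x_j\partial x_k}dx_j\otimes dx_k$ for a smooth convex $\phi$ (a potential); $(X,\nabla,g)$ is then a Hessian manifold. A weak Hessian metric is a collection of (not necessarily smooth) convex functions $\phi_i$ on the sets $U_i$ of an open cover by affine charts such that $\phi_i-\phi_j$ is affine on overlaps; it is a smooth Hessian metric if the $\phi_i$ are smooth with positive definite Hessian in affine coordinates. The dual of $(X,\nabla,g)$ is the Hessian manifold $(X,\nabla',g)$ with $\nabla'=2\nabla_g-\nabla$, $\nabla_g$ the Levi-Civita connection of $g$; equivalently, locally $\nabla'$ is the pullback of the flat connection on $(\mathbb{R}^d)^*$ by the gradient map of a local potential of $g$. Polytopes. $M_{\mathbb{R}}$ is a real vector space of dimension $d+1$ ($d\ge1$), $N_{\mathbb{R}}=(M_{\mathbb{R}})^*$, $M\subset M_{\mathbb{R}}$ is a lattice, $N\subset N_{\mathbb{R}}$ the dual lattice, $\langle\cdot,\cdot\rangle$ the pairing. A reflexive polytope $\Delta\subset M_{\mathbb{R}}$ is a lattice polytope (convex hull of finitely many points of $M$) whose dual $\Delta^\vee=\{n\in N_{\mathbb{R}}:\langle m,n\rangle\le1\text{ for all }m\in\Delta\}$ is also a lattice polytope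 (with respect to $N$); then $(\Delta^\vee)^\vee=\Delta$. For a facet $\sigma$ of $\Delta$, $n_\sigma$ is the corresponding vertex of $\Delta^\vee$; for a facet $\tau$ of $\Delta^\vee$, $m_\tau$ is the corresponding vertex of $\Delta$ (so $\langle\cdot,n_\sigma\rangle=1$ on $\sigma$ and $\langle m_\tau,\cdot\rangle=1$ on $\tau$). $\sigma^\circ,\tau^\circ$ are relative interiors. For $m\in\partial\Delta$, $\mathrm{Star}(m)$ is the union of the closed faces in $\partial\Delta$ containing $m$; similarly for $n\in\partial\Delta^\vee$. $c$-gradients. For $m\in\partial\Delta$, $n\in\partial\Delta^\vee$, we write $n\in\partial^c\Phi(m)$, equivalently $m\in\partial^c\Psi(n)$, if $\Phi(m)+\Psi(n)=\langle m,n\rangle$. Thus $\partial^c\Phi$ and $\partial^c\Psi$ are multivalued maps between $\partial\Delta$ and $\partial\Delta^\vee$ that are inverse to each other. Structure on $\partial\Delta$ induced by $\Phi$. For each facet $\tau$ of $\Delta^\vee$ put $U_\tau=\partial\Delta\setminus\partial^c\Psi(\partial\Delta^\vee\setminus\tau^\circ)$, which under the homeomorphism assumption equals $\partial^c\Psi(\tau^\circ)$ and is an open subset of $\mathrm{Star}(m_\tau)$. Choose generators $n_1,\dots,n_d$ of the lattice $N\cap m_\tau^\perp$ and let $\alpha_\tau(m)=(\langle m,n_1\rangle,\dots,\langle m,n_d\rangle)$ on $\mathrm{Star}(m_\tau)$. The domain is $X=\bigcup_\sigma\sigma^\circ\cup\bigcup_\tau U_\tau\subset\partial\Delta$, and the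 distinguished atlas consists of the charts $(U_\tau,\alpha_\tau|_{U_\tau})$ for all facets $\tau$ of $\Delta^\vee$ and $(\sigma^\circ,\alpha_\tau|_{\sigma^\circ})$ for all pairs of facets $\sigma$ of $\Delta$, $\tau$ of $\Delta^\vee$ with $m_\tau\in\sigma$ (equivalently $n_\sigma\in\tau$). The weak Hessian metric induced by $\Phi$ has local potential $\Phi|_{\sigma^\circ}$ on the charts $(\sigma^\circ,\alpha_\tau)$ and $(\Phi-\langle\cdot,n\rangle)|_{U_\tau}$, for any vertex $n$ of $\tau$, on the chart $(U_\tau,\alpha_\tau)$. Structure on $\partial\Delta^\vee$ induced by $\Psi$. This is defined in the same way with the roles of $(\Delta,\Phi,M)$ and $(\Delta^\vee,\Psi,N)$ exchanged: for each facet $\sigma$ of $\Delta$, $U_\sigma=\partial\Delta^\vee\setminus\partial^c\Phi(\partial\Delta\setminus\sigma^\circ)=\partial^c\Phi(\sigma^\circ)\subset\mathrm{Star}(n_\sigma)$; $\alpha_\sigma(n)=(\langle m_1,n\rangle,\dots,\langle m_d,n\rangle)$ for generators $m_1,\dots,m_d$ of $M\cap n_\sigma^\perp$; the domain is $\bigcup_\tau\tau^\circ\cup\bigcup_\sigma U_\sigma$; the charts are $(U_\sigma,\alpha_\sigma)$ and $(\tau^\circ,\alpha_\sigma|_{\tau^\circ})$ for $n_\sigma\in\tau$; the potentials are $\Psi|_{\tau^\circ}$ on $\tau^\circ$ and $(\Psi-\langle m,\cdot\rangle)|_{U_\sigma}$, for any vertex $m$ of $\sigma$, on $U_\sigma$.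 *)

theory Defs
  imports "HOL-Analysis.Analysis"
begin

section \<open>Calculus in coordinates\<close>

primrec Ck_on :: "nat \<Rightarrow> 'v::real_normed_vector set \<Rightarrow> ('v \<Rightarrow> 'w::real_normed_vector) \<Rightarrow> bool" where
  "Ck_on 0 S f \<longleftrightarrow> continuous_on S f"
| "Ck_on (Suc k) S f \<longleftrightarrow> (\<forall>x\<in>S. f differentiable (at x)) \<and>
     (\<forall>v. Ck_on k S (\<lambda>x. frechet_derivative f (at x) v))"

text \<open>Only meant for open sets \<open>S\<close>; the values of \<open>f\<close> outside \<open>S\<close> are then irrelevant.\<close>

definition smooth_on :: "'v::real_normed_vector set \<Rightarrow> ('v \<Rightarrow> 'w::real_normed_vector) \<Rightarrow> bool" where
  "smooth_on S f \<longleftrightarrow> (\<forall>k. Ck_on k S f)"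

definition pderiv_at :: "'d::finite \<Rightarrow> (real^'d \<Rightarrow> real) \<Rightarrow> real^'d \<Rightarrow> real" where
  "pderiv_at j f x = frechet_derivative f (at x) (axis j 1)"

definition hessian :: "(real^'d \<Rightarrow> real) \<Rightarrow> real^'d \<Rightarrow> real^'d^'d::finite" where
  "hessian f x = (\<chi> j k. pderiv_at j (pderiv_at k f) x)"

definition pos_def :: "real^'d^'d::finite \<Rightarrow> bool" where
  "pos_def A \<longleftrightarrow> (\<forall>v. v \<noteq> 0 \<longrightarrow> v \<bullet> (A *v v) > 0)"

definition locally_affine_on ::
    "'v::real_normed_vector set \<Rightarrow> ('v \<Rightarrow> 'w::real_vector) \<Rightarrow> bool" where
  "locally_affine_on S f \<longleftrightarrow>
     (\<forall>x\<in>S. \<exists>W L c. open W \<and> x \<in> W \<and> linear L \<and> (\<forall>y\<in>S \<inter> W. f y = L y + c))"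


section \<open>Affine and Hessian manifolds\<close>

text \<open>
  Manifolds are subsets of an ambient Euclidean space with the subspace topology.  A chart
  \<open>(U, \<alpha>, \<phi>)\<close> consists of a domain, affine coordinates, and a local potential on the domain;
  \<open>\<alpha>\<close> and \<open>\<phi>\<close> are total functions of which only the restrictions to \<open>U\<close> matter.
\<close>

type_synonym ('a, 'd) hchart = "'a set \<times> ('a \<Rightarrow> real^'d) \<times> ('a \<Rightarrow> real)"

definition chart_dom :: "('a, 'd::finite) hchart \<Rightarrow> 'a set" where
  "chart_dom c = fst c"

definition chart_map :: "('a, 'd::finite) hchart \<Rightarrow> 'a \<Rightarrow> real^'d" where
  "chart_map c = fst (snd c)"

definition chart_pot :: "('a, 'd::finite) hchart \<Rightarrow> 'a \<Rightarrow> real" where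
  "chart_pot c = snd (snd c)"

definition chart_inv :: "('a, 'd::finite) hchart \<Rightarrow> real^'d \<Rightarrow> 'a" where
  "chart_inv c = inv_into (chart_dom c) (chart_map c)"

definition affine_atlas ::
    "'a::topological_space set \<Rightarrow> ('a, 'd::finite) hchart set \<Rightarrow> bool" where
  "affine_atlas X A \<longleftrightarrow>
     (\<Union>c\<in>A. chart_dom c) = X \<and>
     (\<forall>c\<in>A. openin (top_of_set X) (chart_dom c) \<and> open (chart_map c ` chart_dom c) \<and>
        homeomorphism (chart_dom c) (chart_map c ` chart_dom c) (chart_map c) (chart_inv c)) \<and>
     (\<forall>c\<in>A. \<forall>c'\<in>A. locally_affine_on (chart_map c ` (chart_dom c \<inter> chart_dom c'))
        (chart_map c' \<circ> chart_inv c))"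

definition compatible_potentials :: "('a, 'd::finite) hchart set \<Rightarrow> bool" where
  "compatible_potentials A \<longleftrightarrow>
     (\<forall>c\<in>A. \<forall>c'\<in>A. locally_affine_on (chart_map c ` (chart_dom c \<inter> chart_dom c'))
        (\<lambda>x. chart_pot c (chart_inv c x) - chart_pot c' (chart_inv c x)))"

text \<open>The matrix of the metric \<open>\<nabla>d\<phi>\<close> in the affine coordinates of a chart.\<close>

definition hess_metric :: "('a, 'd::finite) hchart \<Rightarrow> real^'d \<Rightarrow> real^'d^'d" where
  "hess_metric c = hessian (chart_pot c \<circ> chart_inv c)"

definition smooth_potentials :: "('a, 'd::finite) hchart set \<Rightarrow> bool" where
  "smooth_potentials A \<longleftrightarrow>
     (\<forall>c\<in>A. smooth_on (chart_map c ` chart_dom c) (chart_pot c \<circ> chart_inv c) \<and>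
        (\<forall>x \<in> chart_map c ` chart_dom c. pos_def (hess_metric c x)))"

definition hessian_manifold ::
    "'a::topological_space set \<Rightarrow> ('a, 'd::finite) hchart set \<Rightarrow> bool" where
  "hessian_manifold X A \<longleftrightarrow>
     affine_atlas X A \<and> compatible_potentials A \<and> smooth_potentials A"

text \<open>
  A connection is given by its Christoffel symbols in every chart: \<open>\<Gamma> c x i j k\<close> is
  \<open>\<Gamma>\<^sup>i\<^sub>j\<^sub>k(x)\<close>, that is, \<open>\<nabla>\<^sub>\<partial>\<^sub>j \<partial>\<^sub>k = \<Sum>i. \<Gamma>\<^sup>i\<^sub>j\<^sub>k \<partial>\<^sub>i\<close>.
\<close>

type_synonym ('a, 'd) connection =
  "('a, 'd) hchart \<Rightarrow> real^'d \<Rightarrow> 'd \<Rightarrow> 'd \<Rightarrow> 'd \<Rightarrow> real"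

text \<open>The connection for which all charts of the atlas are affine coordinates.\<close>

definition flat_connection :: "('a, 'd::finite) connection" where
  "flat_connection c x i j k = 0"

text \<open>The torsion-free connection with \<open>\<nabla>g = 0\<close>, for a metric with matrix \<open>g\<close> in coordinates.\<close>

definition torsion_free_metric ::
    "(real^'d \<Rightarrow> real^'d^'d) \<Rightarrow> real^'d \<Rightarrow> ('d::finite \<Rightarrow> 'd \<Rightarrow> 'd \<Rightarrow> real) \<Rightarrow> bool" where
  "torsion_free_metric g x G \<longleftrightarrow>
     (\<forall>i j k. G i j k = G i k j) \<and>
     (\<forall>l j k. pderiv_at l (\<lambda>y. g y $ j $ k) x =
        (\<Sum>i\<in>UNIV. G i l j * g x $ i $ k) + (\<Sum>i\<in>UNIV. G i l k * g x $ j $ i))"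

definition levi_civita :: "(real^'d \<Rightarrow> real^'d^'d) \<Rightarrow> real^'d \<Rightarrow> 'd::finite \<Rightarrow> 'd \<Rightarrow> 'd \<Rightarrow> real" where
  "levi_civita g x = (THE G. torsion_free_metric g x G)"

text \<open>\<open>\<nabla>' = 2\<nabla>\<^sub>g - \<nabla>\<close>, for the metric with matrix \<open>g c\<close> in the chart \<open>c\<close>.\<close>

definition dual_connection ::
    "(('a, 'd::finite) hchart \<Rightarrow> real^'d \<Rightarrow> real^'d^'d) \<Rightarrow> ('a, 'd) connection \<Rightarrow> ('a, 'd) connection"
  where "dual_connection g \<Gamma> c x i j k = 2 * levi_civita (g c) x i j k - \<Gamma> c x i j k"

definition local_rep ::
    "('a, 'd::finite) hchart \<Rightarrow> ('b, 'd) hchart \<Rightarrow> ('a \<Rightarrow> 'b) \<Rightarrow> real^'d \<Rightarrow> real^'d" where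
  "local_rep c c' F = chart_map c' \<circ> F \<circ> chart_inv c"

definition local_dom ::
    "('a, 'd::finite) hchart \<Rightarrow> ('b, 'd) hchart \<Rightarrow> ('a \<Rightarrow> 'b) \<Rightarrow> (real^'d) set" where
  "local_dom c c' F = chart_map c ` (chart_dom c \<inter> F -` chart_dom c')"

definition diffeo_between ::
    "'a::topological_space set \<Rightarrow> ('a, 'd::finite) hchart set \<Rightarrow>
     'b::topological_space set \<Rightarrow> ('b, 'd) hchart set \<Rightarrow> ('a \<Rightarrow> 'b) \<Rightarrow> bool" where
  "diffeo_between X A Y B F \<longleftrightarrow>
     (\<exists>F'. homeomorphism X Y F F' \<and>
        (\<forall>c\<in>A. \<forall>c'\<in>B. smooth_on (local_dom c c' F) (local_rep c c' F) \<and>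
                        smooth_on (local_dom c' c F') (local_rep c' c F')))"

text \<open>
  Transformation law for Christoffel symbols: \<open>F\<close> carries the connection \<open>\<Gamma>\<close> to \<open>\<Gamma>'\<close>.
\<close>

definition preserves_connection ::
    "('a, 'd::finite) hchart set \<Rightarrow> ('a, 'd) connection \<Rightarrow>
     ('b, 'd) hchart set \<Rightarrow> ('b, 'd) connection \<Rightarrow> ('a \<Rightarrow> 'b) \<Rightarrow> bool" where
  "preserves_connection A \<Gamma> B \<Gamma>' F \<longleftrightarrow>
     (\<forall>c\<in>A. \<forall>c'\<in>B. \<forall>x\<in>local_dom c c' F. \<forall>a j k.
        let f = (\<lambda>a y. local_rep c c' F y $ a) in
        pderiv_at j (pderiv_at k (f a)) x +
          (\<Sum>p\<in>UNIV. \<Sum>q\<in>UNIV. \<Gamma>' c' (local_rep c c' F x) a p q *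
             pderiv_at j (f p) x * pderiv_at k (f q) x) =
        (\<Sum>i\<in>UNIV. \<Gamma> c x i j k * pderiv_at i (f a) x))"

definition affine_isomorphism ::
    "'a::topological_space set \<Rightarrow> ('a, 'd::finite) hchart set \<Rightarrow> ('a, 'd) connection \<Rightarrow>
     'b::topological_space set \<Rightarrow> ('b, 'd) hchart set \<Rightarrow> ('b, 'd) connection \<Rightarrow>
     ('a \<Rightarrow> 'b) \<Rightarrow> bool" where
  "affine_isomorphism X A \<Gamma> Y B \<Gamma>' F \<longleftrightarrow>
     diffeo_between X A Y B F \<and> preserves_connection A \<Gamma> B \<Gamma>' F"

text \<open>\<open>g = F\<^sup>*h\<close> in all pairs of charts.\<close>

definition preserves_metric ::
    "('a, 'd::finite) hchart set \<Rightarrow> (('a, 'd) hchart \<Rightarrow> real^'d \<Rightarrow> real^'d^'d) \<Rightarrow>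
     ('b, 'd) hchart set \<Rightarrow> (('b, 'd) hchart \<Rightarrow> real^'d \<Rightarrow> real^'d^'d) \<Rightarrow> ('a \<Rightarrow> 'b) \<Rightarrow> bool" where
  "preserves_metric A g B h F \<longleftrightarrow>
     (\<forall>c\<in>A. \<forall>c'\<in>B. \<forall>x\<in>local_dom c c' F. \<forall>j k.
        let f = (\<lambda>a y. local_rep c c' F y $ a) in
        g c x $ j $ k =
        (\<Sum>p\<in>UNIV. \<Sum>q\<in>UNIV. h c' (local_rep c c' F x) $ p $ q *
           pderiv_at j (f p) x * pderiv_at k (f q) x))"


section \<open>Reflexive polytopes\<close>

text \<open>
  The space \<open>M\<^sub>\<real>\<close> is a Euclidean space and its dual \<open>N\<^sub>\<real>\<close> is identified with it through the inner
  product, which thereby is the pairing.  The lattice is arbitrary, so this loses no generality.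
\<close>

definition full_lattice :: "'a::euclidean_space set \<Rightarrow> bool" where
  "full_lattice M \<longleftrightarrow>
     (\<exists>E. independent E \<and> span E = UNIV \<and>
        M = range (\<lambda>k :: 'a \<Rightarrow> int. \<Sum>e\<in>E. of_int (k e) *\<^sub>R e))"

definition dual_lattice :: "'a::euclidean_space set \<Rightarrow> 'a set" where
  "dual_lattice M = {n. \<forall>m\<in>M. m \<bullet> n \<in> \<int>}"

definition dual_polytope :: "'a::euclidean_space set \<Rightarrow> 'a set" where
  "dual_polytope D = {n. \<forall>m\<in>D. m \<bullet> n \<le> 1}"

definition lattice_polytope :: "'a::euclidean_space set \<Rightarrow> 'a set \<Rightarrow> bool" where
  "lattice_polytope M D \<longleftrightarrow> (\<exists>S. finite S \<and> S \<subseteq> M \<and> D = convex hull S)"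

text \<open>Boundedness of the dual forces \<open>0\<close> to be an interior point, so \<open>D\<close> is full-dimensional.\<close>

definition reflexive_polytope :: "'a::euclidean_space set \<Rightarrow> 'a set \<Rightarrow> bool" where
  "reflexive_polytope M D \<longleftrightarrow>
     lattice_polytope M D \<and> lattice_polytope (dual_lattice M) (dual_polytope D)"

text \<open>
  For a facet \<open>\<sigma>\<close> of a polytope with dual polytope \<open>D'\<close>, the vertex \<open>n\<^sub>\<sigma>\<close> of \<open>D'\<close> (and
  likewise \<open>m\<^sub>\<tau>\<close> for a facet \<open>\<tau>\<close> of \<open>D'\<close>, with \<open>D\<close> in place of \<open>D'\<close>).
\<close>

definition facet_vertex :: "'a::euclidean_space set \<Rightarrow> 'a set \<Rightarrow> 'a" where
  "facet_vertex D' \<sigma> = (THE n. n extreme_point_of D' \<and> (\<forall>m\<in>\<sigma>. m \<bullet> n = 1))"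

definition generates_lattice :: "('d::finite \<Rightarrow> 'a::euclidean_space) \<Rightarrow> 'a set \<Rightarrow> bool" where
  "generates_lattice b L \<longleftrightarrow> L = range (\<lambda>k :: 'd \<Rightarrow> int. \<Sum>i\<in>UNIV. of_int (k i) *\<^sub>R b i)"


section \<open>The structure induced on the boundary of a polytope\<close>

text \<open>
  Everything is stated for \<open>(D, D', \<Phi>, \<Psi>)\<close>, where \<open>D'\<close> is the dual of \<open>D\<close>; the structure on the
  boundary of \<open>D'\<close> is obtained by exchanging the roles, i.e. from \<open>(D', D, \<Psi>, \<Phi>)\<close>.
\<close>

definition c_transform :: "'a::euclidean_space set \<Rightarrow> ('a \<Rightarrow> real) \<Rightarrow> 'a \<Rightarrow> real" where
  "c_transform D \<Phi> n = (SUP m\<in>frontier D. m \<bullet> n - \<Phi> m)"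

definition c_gradient ::
    "'a::euclidean_space set \<Rightarrow> 'a set \<Rightarrow> ('a \<Rightarrow> real) \<Rightarrow> ('a \<Rightarrow> real) \<Rightarrow> 'a \<Rightarrow> 'a set" where
  "c_gradient D D' \<Phi> \<Psi> m = {n. m \<in> frontier D \<and> n \<in> frontier D' \<and> \<Phi> m + \<Psi> n = m \<bullet> n}"

definition vertex_chart_dom ::
    "'a::euclidean_space set \<Rightarrow> 'a set \<Rightarrow> ('a \<Rightarrow> real) \<Rightarrow> ('a \<Rightarrow> real) \<Rightarrow> 'a set \<Rightarrow> 'a set" where
  "vertex_chart_dom D D' \<Phi> \<Psi> \<tau> =
     frontier D - (\<Union>n \<in> frontier D' - rel_interior \<tau>. c_gradient D' D \<Psi> \<Phi> n)"

definition lattice_coords :: "('d::finite \<Rightarrow> 'a::euclidean_space) \<Rightarrow> 'a \<Rightarrow> real^'d" where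
  "lattice_coords b m = (\<chi> i. m \<bullet> b i)"

definition induced_domain ::
    "'a::euclidean_space set \<Rightarrow> 'a set \<Rightarrow> ('a \<Rightarrow> real) \<Rightarrow> ('a \<Rightarrow> real) \<Rightarrow> 'a set" where
  "induced_domain D D' \<Phi> \<Psi> =
     (\<Union>\<sigma> \<in> {\<sigma>. \<sigma> facet_of D}. rel_interior \<sigma>) \<union>
     (\<Union>\<tau> \<in> {\<tau>. \<tau> facet_of D'}. vertex_chart_dom D D' \<Phi> \<Psi> \<tau>)"

text \<open>
  \<open>b \<tau>\<close> is the chosen family of generators of \<open>N \<inter> m\<^sub>\<tau>\<^sup>\<bottom>\<close>.  On \<open>U\<^sub>\<tau>\<close> the potentials for all
  vertices \<open>n\<close> of \<open>\<tau>\<close> are included; they differ by affine functions.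
\<close>

definition induced_atlas ::
    "'a::euclidean_space set \<Rightarrow> 'a set \<Rightarrow> ('a \<Rightarrow> real) \<Rightarrow> ('a \<Rightarrow> real) \<Rightarrow>
     ('a set \<Rightarrow> 'd::finite \<Rightarrow> 'a) \<Rightarrow> ('a, 'd) hchart set" where
  "induced_atlas D D' \<Phi> \<Psi> b =
     {(vertex_chart_dom D D' \<Phi> \<Psi> \<tau>, lattice_coords (b \<tau>), \<lambda>m. \<Phi> m - m \<bullet> n) | \<tau> n.
        \<tau> facet_of D' \<and> n extreme_point_of \<tau>} \<union>
     {(rel_interior \<sigma>, lattice_coords (b \<tau>), \<Phi>) | \<sigma> \<tau>.
        \<sigma> facet_of D \<and> \<tau> facet_of D' \<and> facet_vertex D \<tau> \<in> \<sigma>}"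

end

theory Submission imports Defs begin

text \<open>
  Contact of \<open>m\<close> and \<open>n = F m\<close> means that the affine function \<open>\<langle>\<cdot>, n\<rangle> - \<Psi> n\<close> supports \<open>\<Phi>\<close> at \<open>m\<close>
  on the boundary of \<open>\<Delta>\<close>. Hence, in every chart, \<open>F\<close> is an affine function of the gradient of the
  local potential \<open>\<phi>\<close>: in coordinates \<open>F = c + P \<nabla>\<phi>\<close>, and by symmetry \<open>F\<^sup>-\<^sup>1 = c' + P\<^sup>T \<nabla>\<psi>\<close> with the
  transposed matrix. The first formula shows that \<open>F\<close> carries \<open>2\<nabla>\<^sub>g - \<nabla>\<close>, whose Christoffel symbols are
  \<open>g\<^sup>-\<^sup>1 \<partial>\<^sup>3\<phi>\<close>, to the flat connection; the chain rule for \<open>F\<^sup>-\<^sup>1 \<circ> F\<close> then compares the metrics.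
  Integrality enters only to show that \<open>U\<^sub>\<tau>\<close> lies in the star of \<open>m\<^sub>\<tau>\<close>, where \<open>\<alpha>\<^sub>\<tau>\<close> is injective.
\<close>

section \<open>Smooth functions and mixed partial derivatives\<close>

text \<open>The gradient of a potential has \<open>CARD('d)\<close> entries, while
  \<open>F m\<close> lives in a space of one dimension more, so one unknown remains. On U_\<tau> it
  is removed by \<open>F m \<bullet> v = 1\<close>. On an open facet with normal \<open>w\<close>
  the gradient does not see the \<open>w\<close>-component of \<open>F m\<close>. That component is
  in general not affine in the gradient over the whole facet. It becomes affine where
  \<open>F m\<close> stays in a single facet of the dual polytope, and it drops out when the target
  coordinates are orthogonal to \<open>w\<close>. Hence P belongs to a pair of charts and not to a
  single chart, and the four combinations of chart types are treated separately.

  The hypotheses on \<Phi> and \<Psi> are not symmetric. The argument therefore runs in a locale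
  that keeps what both functions share: the inequality
  \<open>m \<bullet> n \<le> \<Phi> m + \<Psi> n\<close>, its equality case, and growth at most
  \<open>s\<close> when moving by \<open>s\<close> times a point of the polytope. Every fact about
  \<open>F\<close> is then also a fact about its inverse \<open>G\<close>. The bounded distance of
  \<Phi> to the support function is used only to obtain this growth.\<close>

lemma frechet_cong_open:
  assumes "open S" "x \<in> S" "\<And>y. y \<in> S \<Longrightarrow> f y = g y"
  shows "frechet_derivative f (at x) = frechet_derivative g (at x)"
proof -
  have "(f has_derivative D) (at x) \<longleftrightarrow> (g has_derivative D) (at x)" for D
    using assms has_derivative_transform_within_open[of f D x UNIV S g]
      has_derivative_transform_within_open[of g D x UNIV S f] by auto
  then show ?thesis
    by (simp add: frechet_derivative_def)
qed

lemma differentiable_cong_open: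
  assumes "open S" "x \<in> S" "\<And>y. y \<in> S \<Longrightarrow> f y = g y"
  shows "f differentiable (at x) \<longleftrightarrow> g differentiable (at x)"
  using assms has_derivative_transform_within_open[of f _ x UNIV S g]
      has_derivative_transform_within_open[of g _ x UNIV S f]
  unfolding differentiable_def by metis

lemma frechet_eqI: "(f has_derivative D) (at x) \<Longrightarrow> frechet_derivative f (at x) = D"
  by (metis frechet_derivative_at)

lemma differentiable_has_frechet:
  "f differentiable (at x) \<Longrightarrow> (f has_derivative frechet_derivative f (at x)) (at x)"
  using frechet_derivative_works by blast

lemma Ck_on_cong:
  assumes "open S" "\<And>y. y \<in> S \<Longrightarrow> f y = g y"
  shows "Ck_on k S f \<longleftrightarrow> Ck_on k S g"
  using assms(2)
proof (induction k arbitrary: f g)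
  case 0
  then show ?case using continuous_on_cong by force
next
  case (Suc k)
  have d: "frechet_derivative f (at x) = frechet_derivative g (at x)" if "x \<in> S" for x
    using frechet_cong_open[OF assms(1) that] Suc.prems by blast
  have "Ck_on k S (\<lambda>x. frechet_derivative f (at x) v) \<longleftrightarrow> Ck_on k S (\<lambda>x. frechet_derivative g (at x) v)" for v
    by (rule Suc.IH) (simp add: d)
  moreover have "f differentiable (at x) \<longleftrightarrow> g differentiable (at x)" if "x \<in> S" for x
    using differentiable_cong_open[OF assms(1) that] Suc.prems by blast
  ultimately show ?case by auto
qed

lemma Ck_on_subset: "Ck_on k S f \<Longrightarrow> T \<subseteq> S \<Longrightarrow> Ck_on k T f"
  by (induction k arbitrary: f) (auto intro: continuous_on_subset)

lemma Ck_on_const: "Ck_on k S (\<lambda>x. c)"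
  by (induction k arbitrary: c) auto

lemma Ck_on_scaleR_const:
  assumes "open S"
  shows "Ck_on k S f \<Longrightarrow> Ck_on k S (\<lambda>x. f x *\<^sub>R w)"
proof (induction k arbitrary: f)
  case 0
  then show ?case by (auto intro!: continuous_intros)
next
  case (Suc k)
  have h: "((\<lambda>x. f x *\<^sub>R w) has_derivative (\<lambda>v. frechet_derivative f (at x) v *\<^sub>R w)) (at x)"
    if "x \<in> S" for x
    using that Suc.prems differentiable_has_frechet[of f x]
    by (auto intro!: derivative_eq_intros)
  have "Ck_on k S (\<lambda>x. frechet_derivative (\<lambda>x. f x *\<^sub>R w) (at x) v)" for v
    using Suc.IH[of "\<lambda>x. frechet_derivative f (at x) v"] Suc.prems
    by (subst Ck_on_cong[OF assms, of _ "\<lambda>x. frechet_derivative f (at x) v *\<^sub>R w"])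
       (auto simp: frechet_eqI[OF h])
  then show ?case
    using h by (auto simp: differentiable_def)
qed

lemma Ck_on_add:
  assumes "open S"
  shows "Ck_on k S f \<Longrightarrow> Ck_on k S g \<Longrightarrow> Ck_on k S (\<lambda>x. f x + g x)"
proof (induction k arbitrary: f g)
  case 0
  then show ?case by (auto intro!: continuous_intros)
next
  case (Suc k)
  have h: "((\<lambda>x. f x + g x) has_derivative
      (\<lambda>v. frechet_derivative f (at x) v + frechet_derivative g (at x) v)) (at x)"
    if "x \<in> S" for x
    using that Suc.prems differentiable_has_frechet[of f x] differentiable_has_frechet[of g x]
    by (auto intro!: derivative_eq_intros)
  have "Ck_on k S (\<lambda>x. frechet_derivative (\<lambda>x. f x + g x) (at x) v)" for v
    using Suc.IH[of "\<lambda>x. frechet_derivative f (at x) v" "\<lambda>x. frechet_derivative g (at x) v"] Suc.prems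
    by (subst Ck_on_cong[OF assms, of _ "\<lambda>x. frechet_derivative f (at x) v + frechet_derivative g (at x) v"])
       (auto simp: frechet_eqI[OF h])
  then show ?case
    using h by (auto simp: differentiable_def)
qed

lemma Ck_on_sum:
  assumes "open S" "finite I" "\<And>i. i \<in> I \<Longrightarrow> Ck_on k S (f i)"
  shows "Ck_on k S (\<lambda>x. \<Sum>i\<in>I. f i x)"
  using assms(2,3) by (induction I) (auto intro!: Ck_on_const Ck_on_add[OF assms(1)])

lemma smooth_on_subset: "smooth_on S f \<Longrightarrow> T \<subseteq> S \<Longrightarrow> smooth_on T f"
  by (auto simp: smooth_on_def intro: Ck_on_subset)

lemma smooth_on_cong: "open S \<Longrightarrow> (\<And>y. y \<in> S \<Longrightarrow> f y = g y) \<Longrightarrow> smooth_on S f \<longleftrightarrow> smooth_on S g"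
  using Ck_on_cong[of S f g] by (auto simp: smooth_on_def)

lemma smooth_on_differentiable: "smooth_on S f \<Longrightarrow> x \<in> S \<Longrightarrow> f differentiable (at x)"
  unfolding smooth_on_def using Ck_on.simps(2)[of 0 S f] by blast

lemma smooth_on_derivative: "smooth_on S f \<Longrightarrow> smooth_on S (\<lambda>x. frechet_derivative f (at x) v)"
  unfolding smooth_on_def by (metis Ck_on.simps(2))

lemma smooth_on_pderiv: "smooth_on S f \<Longrightarrow> smooth_on S (pderiv_at j f)"
  using smooth_on_derivative[of S f "axis j 1"] by (simp add: pderiv_at_def[abs_def])

lemma smooth_on_continuous: "smooth_on S f \<Longrightarrow> continuous_on S f"
  unfolding smooth_on_def using Ck_on.simps(1)[of S f] by blast

section \<open>Symmetry of second derivatives\<close>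

lemma mixed_second_difference:
  fixes f :: "'v::real_normed_vector \<Rightarrow> real"
  assumes "smooth_on S f" "0 < t"
    and S: "\<And>s r. 0 \<le> s \<Longrightarrow> s \<le> t \<Longrightarrow> 0 \<le> r \<Longrightarrow> r \<le> t \<Longrightarrow> x + s *\<^sub>R e + r *\<^sub>R e' \<in> S"
  obtains p q where "0 \<le> p" "p \<le> t" "0 \<le> q" "q \<le> t"
    "f (x + t *\<^sub>R e + t *\<^sub>R e') - f (x + t *\<^sub>R e) - f (x + t *\<^sub>R e') + f x =
      t * t * frechet_derivative (\<lambda>y. frechet_derivative f (at y) e) (at (x + p *\<^sub>R e + q *\<^sub>R e')) e'"
proof -
  let ?D = "\<lambda>y. frechet_derivative f (at y) e"
  \<comment> \<open>The second difference is the increment of \<open>u\<close> over [0, t]. The mean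
    value theorem in direction \<open>e\<close>, and then in direction \<open>e'\<close>, yields the
    two factors \<open>t\<close>.\<close>
  define u where "u s = f (x + s *\<^sub>R e + t *\<^sub>R e') - f (x + s *\<^sub>R e)" for s
  have d: "((\<lambda>s. f (x + s *\<^sub>R e + r *\<^sub>R e')) has_real_derivative ?D (x + s *\<^sub>R e + r *\<^sub>R e')) (at s)"
    if "0 \<le> s" "s \<le> t" "0 \<le> r" "r \<le> t" for s r
  proof -
    note h = differentiable_has_frechet[OF smooth_on_differentiable[OF assms(1) S[OF that]]]
    have "((\<lambda>s. f (x + s *\<^sub>R e + r *\<^sub>R e')) has_derivative
      (\<lambda>z. frechet_derivative f (at (x + s *\<^sub>R e + r *\<^sub>R e')) (z *\<^sub>R e))) (at s)"
      by (rule has_derivative_compose[where f = "\<lambda>s. x + s *\<^sub>R e + r *\<^sub>R e'" and g = f, OF _ h])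
         (auto intro!: derivative_eq_intros)
    then show ?thesis
      unfolding has_field_derivative_def
      by (simp add: linear_cmul[OF has_derivative_linear[OF h]] mult.commute[of _ "?D _"])
  qed
  have "\<exists>p. 0 < p \<and> p < t \<and> u t - u 0 = (t - 0) * (?D (x + p *\<^sub>R e + t *\<^sub>R e') - ?D (x + p *\<^sub>R e))"
  proof (rule MVT2[OF assms(2)])
    fix s assume s: "0 \<le> s" "s \<le> t"
    show "(u has_real_derivative ?D (x + s *\<^sub>R e + t *\<^sub>R e') - ?D (x + s *\<^sub>R e)) (at s)"
      unfolding u_def using d[OF s, of t] d[OF s, of 0] assms(2)
      by (auto intro!: derivative_eq_intros)
  qed
  then obtain p where p: "0 < p" "p < t" "u t - u 0 = t * (?D (x + p *\<^sub>R e + t *\<^sub>R e') - ?D (x + p *\<^sub>R e))"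
    by auto
  let ?E = "\<lambda>y. frechet_derivative ?D (at y) e'"
  have "\<exists>q. 0 < q \<and> q < t \<and> ?D (x + p *\<^sub>R e + t *\<^sub>R e') - ?D (x + p *\<^sub>R e + 0 *\<^sub>R e') =
      (t - 0) * ?E (x + p *\<^sub>R e + q *\<^sub>R e')"
  proof (rule MVT2[OF assms(2)])
    fix r assume r: "0 \<le> r" "r \<le> t"
    note h = differentiable_has_frechet[OF smooth_on_differentiable[OF smooth_on_derivative[OF assms(1)] S[OF _ _ r]], of p e]
    have h: "(?D has_derivative frechet_derivative ?D (at (x + p *\<^sub>R e + r *\<^sub>R e'))) (at (x + p *\<^sub>R e + r *\<^sub>R e'))"
      using h p by auto
    have "((\<lambda>r. ?D (x + p *\<^sub>R e + r *\<^sub>R e')) has_derivative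
      (\<lambda>z. frechet_derivative ?D (at (x + p *\<^sub>R e + r *\<^sub>R e')) (z *\<^sub>R e'))) (at r)"
      by (rule has_derivative_compose[where f = "\<lambda>r. x + p *\<^sub>R e + r *\<^sub>R e'" and g = ?D, OF _ h])
         (auto intro!: derivative_eq_intros)
    then show "((\<lambda>r. ?D (x + p *\<^sub>R e + r *\<^sub>R e')) has_real_derivative ?E (x + p *\<^sub>R e + r *\<^sub>R e')) (at r)"
      unfolding has_field_derivative_def
      by (simp add: linear_cmul[OF has_derivative_linear[OF h]] mult.commute[of _ "?E _"])
  qed
  then obtain q where q: "0 < q" "q < t"
    "?D (x + p *\<^sub>R e + t *\<^sub>R e') - ?D (x + p *\<^sub>R e) = t * ?E (x + p *\<^sub>R e + q *\<^sub>R e')" by auto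
  show ?thesis
  proof (rule that[of p q])
    show "f (x + t *\<^sub>R e + t *\<^sub>R e') - f (x + t *\<^sub>R e) - f (x + t *\<^sub>R e') + f x = t * t * ?E (x + p *\<^sub>R e + q *\<^sub>R e')"
      using p(3) q(3) by (simp add: u_def)
  qed (use p q in auto)
qed

text \<open>The second difference is symmetric in \<open>e\<close> and \<open>e'\<close>. Divided by
  the squared step it equals either mixed derivative at a point near \<open>x\<close>; continuity of
  both derivatives identifies the limits.\<close>

lemma smooth_on_mixed_derivatives:
  fixes f :: "'v::real_normed_vector \<Rightarrow> real"
  assumes "open S" "x \<in> S" "smooth_on S f"
  shows "frechet_derivative (\<lambda>y. frechet_derivative f (at y) e) (at x) e' =
    frechet_derivative (\<lambda>y. frechet_derivative f (at y) e') (at x) e"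
proof -
  let ?A = "\<lambda>e e' y. frechet_derivative (\<lambda>y. frechet_derivative f (at y) e) (at y) e'"
  obtain r where r: "r > 0" "ball x r \<subseteq> S" using assms open_contains_ball by blast
  \<comment> \<open>Symmetric in \<open>e\<close> and \<open>e'\<close>, so one step size serves
    both orders; the summand 1 keeps \<open>K\<close> positive when both vectors vanish.\<close>
  define K where "K = norm e + norm e' + 1"
  have K: "K > 0" by (simp add: K_def add_nonneg_pos)
  \<comment> \<open>With \<open>n + 2\<close>, the product \<open>t n * K\<close> is strictly below
    \<open>r\<close> already for \<open>n = 0\<close>.\<close>
  define t where "t n = r / (K * real (n + 2))" for n
  have t0: "t n > 0" for n using r K by (simp add: t_def)
  have "(\<lambda>n. (r / K) * inverse (real (Suc (Suc n)))) \<longlonglongrightarrow> (r / K) * 0"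
    by (intro tendsto_mult tendsto_const LIMSEQ_Suc[OF LIMSEQ_inverse_real_of_nat])
  then have tlim: "t \<longlonglongrightarrow> 0" by (simp add: t_def[abs_def] field_simps)
  have tK: "t n * K < r" for n
  proof -
    have "t n * K = r / real (n + 2)" using K by (simp add: t_def)
    also have "\<dots> < r" using r by (simp add: divide_less_eq)
    finally show ?thesis .
  qed
  have in_S: "x + s *\<^sub>R a + q *\<^sub>R b \<in> S"
    if "0 \<le> s" "s \<le> t n" "0 \<le> q" "q \<le> t n" "norm a + norm b + 1 = K" for n s q a b
  proof -
    have "norm (s *\<^sub>R a + q *\<^sub>R b) \<le> s * norm a + q * norm b"
      using that norm_triangle_ineq[of "s *\<^sub>R a" "q *\<^sub>R b"] by simp
    also have "\<dots> \<le> t n * norm a + t n * norm b"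
      using that by (intro add_mono mult_right_mono) auto
    also have "\<dots> \<le> t n * K"
      using that(5) t0[of n] by (auto simp: algebra_simps)
    finally have "x + s *\<^sub>R a + q *\<^sub>R b \<in> ball x r"
      using tK[of n] by (simp add: dist_norm add.assoc norm_minus_commute add.commute)
    then show ?thesis using r by blast
  qed
  have cont: "isCont (?A a b) x" for a b
    using smooth_on_continuous[OF smooth_on_derivative[OF smooth_on_derivative[OF assms(3)]]] assms
      continuous_on_eq_continuous_at by blast
  have ex: "\<exists>y. (\<forall>n. f (x + t n *\<^sub>R a + t n *\<^sub>R b) - f (x + t n *\<^sub>R a) - f (x + t n *\<^sub>R b) + f x =
      t n * t n * ?A a b (y n)) \<and> y \<longlonglongrightarrow> x" if ab: "norm a + norm b + 1 = K" for a b
  proof -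
    have "\<exists>p q. 0 \<le> p \<and> p \<le> t n \<and> 0 \<le> q \<and> q \<le> t n \<and>
       f (x + t n *\<^sub>R a + t n *\<^sub>R b) - f (x + t n *\<^sub>R a) - f (x + t n *\<^sub>R b) + f x =
      t n * t n * ?A a b (x + p *\<^sub>R a + q *\<^sub>R b)" for n
      using mixed_second_difference[OF assms(3) t0[of n], of x a b] in_S[OF _ _ _ _ ab] by metis
    then obtain p q where pq: "\<And>n. 0 \<le> p n" "\<And>n. p n \<le> t n" "\<And>n. 0 \<le> q n" "\<And>n. q n \<le> t n"
       "\<And>n. f (x + t n *\<^sub>R a + t n *\<^sub>R b) - f (x + t n *\<^sub>R a) - f (x + t n *\<^sub>R b) + f x =
      t n * t n * ?A a b (x + p n *\<^sub>R a + q n *\<^sub>R b)" by metis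
    have "p \<longlonglongrightarrow> 0" by (rule tendsto_sandwich[OF _ _ tendsto_const tlim]) (use pq in auto)
    moreover have "q \<longlonglongrightarrow> 0" by (rule tendsto_sandwich[OF _ _ tendsto_const tlim]) (use pq in auto)
    ultimately have "(\<lambda>n. x + p n *\<^sub>R a + q n *\<^sub>R b) \<longlonglongrightarrow> x + 0 *\<^sub>R a + 0 *\<^sub>R b"
      by (intro tendsto_intros)
    then show ?thesis using pq(5) by (intro exI[of _ "\<lambda>n. x + p n *\<^sub>R a + q n *\<^sub>R b"]) auto
  qed
  obtain y where y: "\<And>n. f (x + t n *\<^sub>R e + t n *\<^sub>R e') - f (x + t n *\<^sub>R e) - f (x + t n *\<^sub>R e') + f x =
      t n * t n * ?A e e' (y n)" "y \<longlonglongrightarrow> x" using ex[of e e'] K_def by auto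
  obtain z where z: "\<And>n. f (x + t n *\<^sub>R e' + t n *\<^sub>R e) - f (x + t n *\<^sub>R e') - f (x + t n *\<^sub>R e) + f x =
      t n * t n * ?A e' e (z n)" "z \<longlonglongrightarrow> x" using ex[of e' e] K_def by auto
  have "?A e e' (y n) = ?A e' e (z n)" for n
  proof -
    have "t n * t n * ?A e e' (y n) = t n * t n * ?A e' e (z n)"
      unfolding y(1)[symmetric] z(1)[symmetric] by (simp add: algebra_simps)
    then show ?thesis using t0[of n] by simp
  qed
  moreover have "(\<lambda>n. ?A e e' (y n)) \<longlonglongrightarrow> ?A e e' x" "(\<lambda>n. ?A e' e (z n)) \<longlonglongrightarrow> ?A e' e x"
    using isCont_tendsto_compose[OF cont y(2)] isCont_tendsto_compose[OF cont z(2)] by auto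
  ultimately show ?thesis using LIMSEQ_unique by force
qed

lemma pderiv_at_commute:
  assumes "open S" "x \<in> S" "smooth_on S f"
  shows "pderiv_at j (pderiv_at k f) x = pderiv_at k (pderiv_at j f) x"
  using smooth_on_mixed_derivatives[OF assms] by (simp add: pderiv_at_def[abs_def])

lemma pderiv_at_cong:
  assumes "open S" "x \<in> S" "\<And>y. y \<in> S \<Longrightarrow> f y = g y"
  shows "pderiv_at j f x = pderiv_at j g x"
  using frechet_cong_open[OF assms] by (simp add: pderiv_at_def)

lemma pderiv_at_affine_combination:
  assumes "\<And>i. f i differentiable (at x)"
  shows "pderiv_at j (\<lambda>y. c + (\<Sum>i\<in>UNIV. a i * f i y)) x = (\<Sum>i\<in>UNIV. a i * pderiv_at j (f i) x)"
proof -
  have "((\<lambda>y. c + (\<Sum>i\<in>UNIV. a i * f i y)) has_derivative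
     (\<lambda>v. \<Sum>i\<in>UNIV. a i * frechet_derivative (f i) (at x) v)) (at x)"
    using differentiable_has_frechet[OF assms]
    by (auto intro!: derivative_eq_intros)
  from frechet_eqI[OF this] show ?thesis by (simp add: pderiv_at_def)
qed

lemma frechet_derivative_coords:
  fixes f :: "real^'d::finite \<Rightarrow> real"
  assumes "f differentiable (at x)"
  shows "frechet_derivative f (at x) v = (\<Sum>i\<in>UNIV. v $ i * pderiv_at i f x)"
proof -
  have l: "linear (frechet_derivative f (at x))"
    using differentiable_has_frechet[OF assms] has_derivative_linear by blast
  have "v = (\<Sum>i\<in>UNIV. (v $ i) *\<^sub>R axis i 1)"
    using basis_expansion[of v] by (simp add: scalar_mult_eq_scaleR)
  then have "frechet_derivative f (at x) v = frechet_derivative f (at x) (\<Sum>i\<in>UNIV. (v $ i) *\<^sub>R axis i 1)"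
    by simp
  also have "\<dots> = (\<Sum>i\<in>UNIV. v $ i * pderiv_at i f x)"
    by (simp add: linear_sum[OF l] linear_cmul[OF l] pderiv_at_def)
  finally show ?thesis .
qed

section \<open>Gradient maps of Hessian metrics\<close>

lemma hessian_symmetric:
  assumes "open S" "x \<in> S" "smooth_on S \<phi>"
  shows "hessian \<phi> x $ j $ k = hessian \<phi> x $ k $ j"
  using pderiv_at_commute[OF assms] by (simp add: hessian_def)

section \<open>The Levi-Civita connection of a Hessian metric\<close>

lemma pos_def_kernel: "pos_def A \<Longrightarrow> A *v x = 0 \<Longrightarrow> x = 0"
  unfolding pos_def_def by (metis inner_zero_right less_irrefl)

lemma pos_def_solve:
  assumes "pos_def A"
  obtains z where "A *v z = y"
proof -
  have "\<exists>B. B ** A = mat 1"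
    using pos_def_kernel[OF assms] matrix_left_invertible_ker by blast
  then obtain B where "B ** A = mat 1" "A ** B = mat 1"
    using matrix_left_right_inverse by blast
  then have "A *v (B *v y) = y"
    by (simp add: matrix_vector_mul_assoc)
  then show ?thesis using that by blast
qed

text \<open>With its upper index lowered, the difference of two solutions is symmetric in the first
  two indices and antisymmetric in the last two. Cyclic permutation forces such a tensor to vanish,
  and positive definiteness lets the index be raised again.\<close>

lemma torsion_free_metric_unique:
  fixes g :: "real^'d \<Rightarrow> real^'d::finite^'d"
  assumes "pos_def (g x)" "\<And>j k. g x $ j $ k = g x $ k $ j"
    and G: "torsion_free_metric g x G" and H: "torsion_free_metric g x H"
  shows "G = H"
proof -
  define D where "D i j k = G i j k - H i j k" for i j k
  define L where "L l j k = (\<Sum>i\<in>UNIV. D i l j * g x $ i $ k)" for l j k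
  have Dsym: "D i j k = D i k j" for i j k
    using G H unfolding D_def torsion_free_metric_def by metis
  have GH: "(\<Sum>i\<in>UNIV. G i l j * g x $ i $ k) + (\<Sum>i\<in>UNIV. G i l k * g x $ j $ i) =
    (\<Sum>i\<in>UNIV. H i l j * g x $ i $ k) + (\<Sum>i\<in>UNIV. H i l k * g x $ j $ i)" for l j k
    using G H unfolding torsion_free_metric_def by metis
  have gsym: "(\<Sum>i\<in>UNIV. h i l k * g x $ j $ i) = (\<Sum>i\<in>UNIV. h i l k * g x $ i $ j)"
    for h :: "'d \<Rightarrow> 'd \<Rightarrow> 'd \<Rightarrow> real" and l j k
    using assms(2)[of j] by (intro sum.cong) auto
  have anti: "L l j k + L l k j = 0" for l j k
    using GH[of l j k] gsym[of G l k j] gsym[of H l k j]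
    unfolding L_def D_def by (simp only: sum_subtractf left_diff_distrib)
  have Lsym: "L l j k = L j l k" for l j k
    unfolding L_def using Dsym by metis
  have L0: "L l j k = 0" for l j k
    using anti[of l j k] anti[of j k l] anti[of k l j] Lsym[of l j k] Lsym[of j k l] Lsym[of k l j] by linarith
  have "D i j k = 0" for i j k
  proof -
    have "(g x *v (\<chi> i. D i j k)) $ l = L j k l" for l
      unfolding L_def using assms(2)[of l] by (auto simp: matrix_vector_mult_def mult.commute intro!: sum.cong)
    then have "g x *v (\<chi> i. D i j k) = 0"
      by (simp add: vec_eq_iff L0)
    then have "(\<chi> i. D i j k) = 0"
      by (rule pos_def_kernel[OF assms(1)])
    then show ?thesis by (simp add: vec_eq_iff)
  qed
  then show ?thesis by (auto simp: D_def fun_eq_iff)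
qed

text \<open>The third derivatives are totally symmetric, so both terms of metric compatibility can
  be half of the third derivative. Solving the linear system for that half gives a candidate, and
  uniqueness identifies it with the \<open>THE\<close> in \<open>levi_civita\<close>. Keeping the
  metric as a factor avoids inverting it.\<close>

lemma levi_civita_hessian:
  fixes \<phi> :: "real^'d::finite \<Rightarrow> real"
  assumes S: "open S" "x \<in> S" and \<phi>: "smooth_on S \<phi>" and pd: "pos_def (hessian \<phi> x)"
  shows "(\<Sum>i\<in>UNIV. levi_civita (hessian \<phi>) x i j k * hessian \<phi> x $ i $ l) =
    pderiv_at j (pderiv_at k (pderiv_at l \<phi>)) x / 2"
proof -
  define T where "T j k l = pderiv_at j (pderiv_at k (pderiv_at l \<phi>)) x" for j k l
  have T1: "T j k l = T k j l" for j k l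
    unfolding T_def by (rule pderiv_at_commute[OF S smooth_on_pderiv[OF \<phi>]])
  have T2: "T j k l = T j l k" for j k l
    unfolding T_def by (rule pderiv_at_cong[OF S]) (rule pderiv_at_commute[OF S(1) _ \<phi>])
  note sym = hessian_symmetric[OF S \<phi>]
  have "\<forall>j k. \<exists>z. hessian \<phi> x *v z = (\<chi> l. T j k l / 2)"
    by (intro allI, rule pos_def_solve[OF pd]) blast
  then obtain z where z: "\<And>j k. hessian \<phi> x *v z j k = (\<chi> l. T j k l / 2)" by metis
  have zsym: "z j k = z k j" for j k
  proof -
    have "hessian \<phi> x *v (z j k - z k j) = 0"
      using z T1[of j k] by (simp add: matrix_vector_mult_diff_distrib)
    then have "z j k - z k j = 0" by (rule pos_def_kernel[OF pd])
    then show ?thesis by simp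
  qed
  define G where "G i j k = z j k $ i" for i j k
  have G: "(\<Sum>i\<in>UNIV. G i j k * hessian \<phi> x $ i $ l) = T j k l / 2" for j k l
  proof -
    have "(\<Sum>i\<in>UNIV. G i j k * hessian \<phi> x $ i $ l) = (hessian \<phi> x *v z j k) $ l"
      using sym[of l] by (auto simp: G_def matrix_vector_mult_def intro!: sum.cong)
    then show ?thesis by (simp add: z)
  qed
  have tf: "torsion_free_metric (hessian \<phi>) x G"
    unfolding torsion_free_metric_def
  proof (intro conjI allI)
    fix i j k show "G i j k = G i k j" by (simp add: G_def zsym[of j k])
  next
    fix l j k
    have "pderiv_at l (\<lambda>y. hessian \<phi> y $ j $ k) x = T l j k"
      by (simp add: hessian_def T_def)
    moreover have "(\<Sum>i\<in>UNIV. G i l k * hessian \<phi> x $ j $ i) = T l j k / 2"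
      using G[of l k j] sym[of j] T2[of l k j] by simp
    ultimately show "pderiv_at l (\<lambda>y. hessian \<phi> y $ j $ k) x =
        (\<Sum>i\<in>UNIV. G i l j * hessian \<phi> x $ i $ k) + (\<Sum>i\<in>UNIV. G i l k * hessian \<phi> x $ j $ i)"
      using G[of l j k] by simp
  qed
  have "levi_civita (hessian \<phi>) x = G"
    unfolding levi_civita_def
    using tf torsion_free_metric_unique[OF pd sym _ tf] by (rule the_equality)
  then show ?thesis using G by (simp add: T_def)
qed

section \<open>Maps that are affine in the gradient\<close>

lemma gradient_map_nth:
  fixes \<phi> :: "real^'d::finite \<Rightarrow> real" and P :: "'e::finite \<Rightarrow> 'd \<Rightarrow> real"
  assumes S: "open S" "x \<in> S" and \<phi>: "smooth_on S \<phi>"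
    and f: "\<And>x. x \<in> S \<Longrightarrow> f x = (\<chi> j. c j + (\<Sum>i\<in>UNIV. P j i * pderiv_at i \<phi> x))"
  shows "pderiv_at k (\<lambda>x. f x $ j) x = (\<Sum>i\<in>UNIV. P j i * hessian \<phi> x $ k $ i)"
proof -
  have "pderiv_at k (\<lambda>x. f x $ j) x = pderiv_at k (\<lambda>x. c j + (\<Sum>i\<in>UNIV. P j i * pderiv_at i \<phi> x)) x"
    by (rule pderiv_at_cong[OF S]) (simp add: f)
  also have "\<dots> = (\<Sum>i\<in>UNIV. P j i * hessian \<phi> x $ k $ i)"
    using pderiv_at_affine_combination[of "\<lambda>i. pderiv_at i \<phi>" x k "c j" "P j"]
      smooth_on_differentiable[OF smooth_on_pderiv[OF \<phi>] S(2)] by (simp add: hessian_def)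
  finally show ?thesis .
qed

lemma gradient_map_smooth:
  fixes \<phi> :: "real^'d::finite \<Rightarrow> real" and P :: "'e::finite \<Rightarrow> 'd \<Rightarrow> real"
  assumes S: "open S" and \<phi>: "smooth_on S \<phi>"
    and f: "\<And>x. x \<in> S \<Longrightarrow> f x = (\<chi> j. c j + (\<Sum>i\<in>UNIV. P j i * pderiv_at i \<phi> x))"
  shows "smooth_on S f"
proof -
  define w where "w i = (\<chi> j. P j i)" for i
  define h where "h x = (\<chi> j. c j) + (\<Sum>i\<in>UNIV. pderiv_at i \<phi> x *\<^sub>R w i)" for x
  have "f x = h x" if "x \<in> S" for x
    by (simp add: vec_eq_iff f[OF that] h_def w_def mult.commute)
  moreover have "smooth_on S h"
    unfolding smooth_on_def
  proof
    fix k
    have "Ck_on k S (\<lambda>x. pderiv_at i \<phi> x *\<^sub>R w i)" for i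
      by (rule Ck_on_scaleR_const[OF S]) (use smooth_on_pderiv[OF \<phi>, of i] in \<open>simp add: smooth_on_def\<close>)
    then have "Ck_on k S (\<lambda>x. \<Sum>i\<in>UNIV. pderiv_at i \<phi> x *\<^sub>R w i)"
      by (intro Ck_on_sum[OF S]) auto
    then show "Ck_on k S h"
      unfolding h_def[abs_def] by (rule Ck_on_add[OF S Ck_on_const])
  qed
  ultimately show ?thesis
    using smooth_on_cong[OF S, of f h] by simp
qed

text \<open>The coefficients \<open>c\<close> and \<open>P\<close> are constant, so second
  derivatives of \<open>f\<close> involve only third derivatives of \<phi>. These are the lowered
  Levi-Civita symbols times 2, and contracting the metric with \<open>P\<close> gives back the first
  derivatives of \<open>f\<close>.\<close>

lemma gradient_map_connection:
  fixes \<phi> :: "real^'d::finite \<Rightarrow> real" and P :: "'e::finite \<Rightarrow> 'd \<Rightarrow> real"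
  assumes S: "open S" "x \<in> S" and \<phi>: "smooth_on S \<phi>" and pd: "pos_def (hessian \<phi> x)"
    and f: "\<And>x. x \<in> S \<Longrightarrow> f x = (\<chi> j. c j + (\<Sum>i\<in>UNIV. P j i * pderiv_at i \<phi> x))"
  shows "pderiv_at j (pderiv_at k (\<lambda>x. f x $ a)) x =
    (\<Sum>i\<in>UNIV. 2 * levi_civita (hessian \<phi>) x i j k * pderiv_at i (\<lambda>x. f x $ a) x)"
proof -
  have "pderiv_at j (pderiv_at k (\<lambda>x. f x $ a)) x =
      pderiv_at j (\<lambda>x. 0 + (\<Sum>l\<in>UNIV. P a l * pderiv_at k (pderiv_at l \<phi>) x)) x"
    by (rule pderiv_at_cong[OF S]) (simp add: gradient_map_nth[OF S(1) _ \<phi> f] hessian_def)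
  also have "\<dots> = (\<Sum>l\<in>UNIV. P a l * pderiv_at j (pderiv_at k (pderiv_at l \<phi>)) x)"
    using pderiv_at_affine_combination[of "\<lambda>l. pderiv_at k (pderiv_at l \<phi>)" x j 0 "P a"]
      smooth_on_differentiable[OF smooth_on_pderiv[OF smooth_on_pderiv[OF \<phi>]] S(2)] by simp
  also have "\<dots> = (\<Sum>l\<in>UNIV. P a l * (2 * (\<Sum>i\<in>UNIV. levi_civita (hessian \<phi>) x i j k * hessian \<phi> x $ i $ l)))"
    by (simp add: levi_civita_hessian[OF S \<phi> pd])
  also have "\<dots> = (\<Sum>l\<in>UNIV. \<Sum>i\<in>UNIV. 2 * levi_civita (hessian \<phi>) x i j k * (P a l * hessian \<phi> x $ i $ l))"
    by (simp add: sum_distrib_left algebra_simps)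
  also have "\<dots> = (\<Sum>i\<in>UNIV. \<Sum>l\<in>UNIV. 2 * levi_civita (hessian \<phi>) x i j k * (P a l * hessian \<phi> x $ i $ l))"
    by (rule sum.swap)
  finally show ?thesis
    by (simp add: gradient_map_nth[OF S \<phi> f] sum_distrib_left)
qed

text \<open>
  By the chain rule \<open>P\<^sup>T H\<^sub>\<psi> P H\<^sub>\<phi> = 1\<close>, hence the pullback of \<open>H\<^sub>\<psi>\<close> along \<open>f\<close>, which is
  \<open>(P H\<^sub>\<phi>)\<^sup>T H\<^sub>\<psi> (P H\<^sub>\<phi>)\<close>, equals \<open>H\<^sub>\<phi>\<close>.
\<close>

lemma gradient_map_metric:
  fixes \<phi> :: "real^'d::finite \<Rightarrow> real" and \<psi> :: "real^'e::finite \<Rightarrow> real" and P :: "'e \<Rightarrow> 'd \<Rightarrow> real"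
  assumes S: "open S" "x \<in> S" and \<phi>: "smooth_on S \<phi>"
    and f: "\<And>x. x \<in> S \<Longrightarrow> f x = (\<chi> j. c j + (\<Sum>i\<in>UNIV. P j i * pderiv_at i \<phi> x))"
    and T: "open T" and \<psi>: "smooth_on T \<psi>"
    and f': "\<And>y. y \<in> T \<Longrightarrow> f' y = (\<chi> i. c' i + (\<Sum>j\<in>UNIV. P j i * pderiv_at j \<psi> y))"
    and inv: "\<And>x. x \<in> S \<Longrightarrow> f x \<in> T \<and> f' (f x) = x"
  shows "hessian \<phi> x $ j $ k = (\<Sum>p\<in>UNIV. \<Sum>q\<in>UNIV. hessian \<psi> (f x) $ p $ q *
    pderiv_at j (\<lambda>x. f x $ p) x * pderiv_at k (\<lambda>x. f x $ q) x)"
proof -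
  have fx: "f x \<in> T" using inv S by blast
  have dnth: "((\<lambda>y. h y $ i) has_derivative (\<lambda>v. D v $ i)) F" if "(h has_derivative D) F"
    for h :: "real^'m::finite \<Rightarrow> real^'n::finite" and D i F
    using bounded_linear.has_derivative[OF bounded_linear_vec_nth that] .
  have df: "f differentiable (at x)"
    using smooth_on_differentiable[OF gradient_map_smooth[OF S(1) \<phi> f] S(2)] .
  have df': "f' differentiable (at (f x))"
    using smooth_on_differentiable[OF gradient_map_smooth[OF T \<psi> f'] fx] .
  let ?Df = "frechet_derivative f (at x)" and ?Df' = "frechet_derivative f' (at (f x))"
  note Df = differentiable_has_frechet[OF df] and Df' = differentiable_has_frechet[OF df']
  have Dnth: "?Df (axis j 1) $ p = pderiv_at j (\<lambda>x. f x $ p) x" for j p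
    using frechet_eqI[OF dnth[OF Df]] by (simp add: pderiv_at_def)
  have chain: "(\<Sum>p\<in>UNIV. pderiv_at j (\<lambda>x. f x $ p) x * pderiv_at p (\<lambda>y. f' y $ i) (f x)) =
      (if i = j then 1 else 0)" for i j
  proof -
    have "((\<lambda>y. f' (f y)) has_derivative (\<lambda>v. ?Df' (?Df v))) (at x)"
      by (rule has_derivative_compose[where f = f and g = f', OF Df Df'])
    then have "((\<lambda>y. y) has_derivative (\<lambda>v. ?Df' (?Df v))) (at x)"
      by (rule has_derivative_transform_within_open[OF _ S]) (use inv in blast)
    then have "(\<lambda>v. ?Df' (?Df v)) = (\<lambda>v. v)"
      by (rule has_derivative_unique[OF _ has_derivative_ident])
    then have "?Df' (?Df (axis j 1)) = axis j 1"
      by (rule fun_cong)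
    then have "?Df' (?Df (axis j 1)) $ i = (if i = j then 1 else 0)"
      by (simp add: axis_def)
    moreover have "?Df' v $ i = (\<Sum>p\<in>UNIV. v $ p * pderiv_at p (\<lambda>y. f' y $ i) (f x))" for v
    proof -
      have "(\<lambda>y. f' y $ i) differentiable (at (f x))"
        using dnth[OF Df'] by (auto simp: differentiable_def)
      from frechet_derivative_coords[OF this, of v] show ?thesis
        unfolding frechet_eqI[OF dnth[OF Df']] .
    qed
    ultimately show ?thesis by (simp add: Dnth)
  qed
  define H K where "H = hessian \<phi> x" and "K = hessian \<psi> (f x)"
  note sym = hessian_symmetric[OF S \<phi>, folded H_def]
  have Df_nth: "pderiv_at k (\<lambda>x. f x $ q) x = (\<Sum>i\<in>UNIV. P q i * H $ k $ i)" for k q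
    unfolding H_def by (rule gradient_map_nth[OF S \<phi> f])
  have Df'_nth: "pderiv_at p (\<lambda>y. f' y $ i) (f x) = (\<Sum>q\<in>UNIV. P q i * K $ p $ q)" for p i
    unfolding K_def by (rule gradient_map_nth[OF T fx \<psi> f'])
  define J where "J p = pderiv_at j (\<lambda>x. f x $ p) x" for p
  \<comment> \<open>Only the second Jacobian factor is expanded. The sum over \<open>q\<close> then
    becomes the Jacobian of \<open>f'\<close>, which \<open>chain\<close> cancels against the intact
    factor \<open>J\<close>.\<close>
  have "(\<Sum>p\<in>UNIV. \<Sum>q\<in>UNIV. K $ p $ q * J p * pderiv_at k (\<lambda>x. f x $ q) x) =
    (\<Sum>p\<in>UNIV. \<Sum>q\<in>UNIV. \<Sum>i\<in>UNIV. K $ p $ q * J p * P q i * H $ k $ i)"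
    by (simp add: Df_nth sum_distrib_left mult.assoc)
  also have "\<dots> = (\<Sum>p\<in>UNIV. \<Sum>i\<in>UNIV. \<Sum>q\<in>UNIV. K $ p $ q * J p * P q i * H $ k $ i)"
    by (intro sum.cong refl sum.swap)
  also have "\<dots> = (\<Sum>i\<in>UNIV. \<Sum>p\<in>UNIV. \<Sum>q\<in>UNIV. K $ p $ q * J p * P q i * H $ k $ i)"
    by (rule sum.swap)
  also have "\<dots> = (\<Sum>i\<in>UNIV. (\<Sum>p\<in>UNIV. J p * (\<Sum>q\<in>UNIV. P q i * K $ p $ q)) * H $ k $ i)"
    by (simp add: sum_distrib_left sum_distrib_right algebra_simps)
  also have "\<dots> = (\<Sum>i\<in>UNIV. (if i = j then 1 else 0) * H $ k $ i)"
    using chain[of j] by (simp add: J_def Df'_nth)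
  also have "\<dots> = H $ j $ k"
    by (simp add: if_distrib[of "\<lambda>z. z * _"] sym[of j k] cong: if_cong)
  finally show ?thesis by (simp add: J_def H_def K_def)
qed

section \<open>Polar pairs of polytopes\<close>

definition verts :: "'a::real_vector set \<Rightarrow> 'a set" where
  "verts D = {v. v extreme_point_of D}"

definition face_at :: "'a::real_inner set \<Rightarrow> 'a \<Rightarrow> 'a set" where
  "face_at D w = D \<inter> {m. m \<bullet> w = 1}"

text \<open>For a vertex \<open>w\<close> of the polar this is the relative interior of a facet,
  written through finitely many inequalities; see \<open>rel_interior_face_at\<close>.\<close>

definition open_face :: "'a::real_inner set \<Rightarrow> 'a set \<Rightarrow> 'a \<Rightarrow> 'a set" where
  "open_face D D' w = {m \<in> D. m \<bullet> w = 1 \<and> (\<forall>w'\<in>verts D' - {w}. m \<bullet> w' < 1)}"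

text \<open>The labels of the facets of \<open>D\<close> through the vertex
  \<open>v\<close>.\<close>

definition adjacent :: "'a::real_inner set \<Rightarrow> 'a \<Rightarrow> 'a set" where
  "adjacent D' v = {w \<in> verts D'. v \<bullet> w = 1}"

text \<open>The union of the facets through \<open>v\<close>. Every proper face through a vertex
  \<open>v\<close> lies in such a facet, so this is Star(v).\<close>

definition star :: "'a::real_inner set \<Rightarrow> 'a set \<Rightarrow> 'a \<Rightarrow> 'a set" where
  "star D D' v = {m \<in> D. \<exists>w\<in>adjacent D' v. m \<bullet> w = 1}"

text \<open>Both polarity equations are recorded to make the locale symmetric under exchanging
  \<open>D\<close> and \<open>D'\<close>. Of the lattices only the integrality of the vertex pairing
  is retained.\<close>

locale polar_pair =
  fixes D D' :: "'a::euclidean_space set"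
  assumes polytope: "polytope D" "polytope D'"
    and polar: "D' = dual_polytope D" "D = dual_polytope D'"
    and integral: "\<And>v w. v \<in> verts D \<Longrightarrow> w \<in> verts D' \<Longrightarrow> v \<bullet> w \<in> \<int>"
begin

lemma swap: "polar_pair D' D"
proof
  show "w \<bullet> v \<in> \<int>" if "w \<in> verts D'" "v \<in> verts D" for v w
    using integral that by (metis inner_commute)
qed (use polytope polar in blast)+

lemma mem_dual_iff: "m \<in> D \<longleftrightarrow> (\<forall>n\<in>D'. n \<bullet> m \<le> 1)" "n \<in> D' \<longleftrightarrow> (\<forall>m\<in>D. m \<bullet> n \<le> 1)"
  by (subst polar(2), simp add: dual_polytope_def, subst polar(1), simp add: dual_polytope_def)

lemma zero_in_interior: "0 \<in> interior D"
proof -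
  obtain R where R: "R > 0" "\<And>n. n \<in> D' \<Longrightarrow> norm n \<le> R"
    using polytope_imp_bounded[OF polytope(2)] by (auto simp: bounded_pos)
  have "ball 0 (1 / R) \<subseteq> D"
  proof
    fix m :: 'a assume "m \<in> ball 0 (1 / R)"
    then have m: "norm m * R \<le> 1" using R by (simp add: field_simps)
    have "n \<bullet> m \<le> 1" if "n \<in> D'" for n
    proof -
      have "n \<bullet> m \<le> norm n * norm m" by (rule norm_cauchy_schwarz)
      also have "\<dots> \<le> R * norm m" using R(2)[OF that] by (simp add: mult_right_mono)
      finally show ?thesis using m by (simp add: mult.commute)
    qed
    then show "m \<in> D" by (simp add: mem_dual_iff(1))
  qed
  then show ?thesis using R by (meson centre_in_ball divide_pos_pos interiorI open_ball zero_less_one)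
qed

lemma vert_nonzero: "v \<in> verts D \<Longrightarrow> v \<noteq> 0"
  using zero_in_interior extreme_point_not_in_interior by (auto simp: verts_def)

lemma finite_verts: "finite (verts D)"
  unfolding verts_def by (rule finite_polyhedron_extreme_points[OF polytope_imp_polyhedron[OF polytope(1)]])

lemma hull_verts: "D = convex hull verts D"
  unfolding verts_def
  using Krein_Milman_Minkowski polytope_imp_compact polytope_imp_convex polytope(1) by blast

lemma verts_subset: "verts D \<subseteq> D"
  by (auto simp: verts_def extreme_point_of_def)

lemma finite_adjacent: "finite (adjacent D v)"
  using finite_verts by (simp add: adjacent_def)

lemma mem_polar_iff: "n \<in> D' \<longleftrightarrow> (\<forall>v\<in>verts D. v \<bullet> n \<le> 1)"
proof
  show "n \<in> D' \<Longrightarrow> \<forall>v\<in>verts D. v \<bullet> n \<le> 1"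
    using verts_subset mem_dual_iff(2) by blast
next
  assume "\<forall>v\<in>verts D. v \<bullet> n \<le> 1"
  then have "convex hull verts D \<subseteq> {m. n \<bullet> m \<le> 1}"
    by (intro hull_minimal convex_halfspace_le) (auto simp: inner_commute)
  then show "n \<in> D'"
    using hull_verts mem_dual_iff(2) by (metis (no_types, lifting) inner_commute mem_Collect_eq subsetD)
qed

lemma mem_iff: "m \<in> D \<longleftrightarrow> (\<forall>w\<in>verts D'. m \<bullet> w \<le> 1)"
  using polar_pair.mem_polar_iff[OF swap] by (simp add: inner_commute)

lemma finite_verts': "finite (verts D')"
  by (rule polar_pair.finite_verts[OF swap])

lemma finite_adjacent': "finite (adjacent D' v)"
  by (rule polar_pair.finite_adjacent[OF swap])

lemma open_strict: "finite A \<Longrightarrow> open {m::'a. \<forall>w\<in>A. m \<bullet> w < 1}"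
proof -
  assume "finite A"
  then have "open (\<Inter>w\<in>A. {m::'a. w \<bullet> m < 1})" by (intro open_INT) (auto intro: open_halfspace_lt)
  moreover have "(\<Inter>w\<in>A. {m::'a. w \<bullet> m < 1}) = {m. \<forall>w\<in>A. m \<bullet> w < 1}" by (auto simp: inner_commute)
  ultimately show ?thesis by simp
qed

lemma interior_iff: "m \<in> interior D \<longleftrightarrow> (\<forall>w\<in>verts D'. m \<bullet> w < 1)"
proof
  assume "\<forall>w\<in>verts D'. m \<bullet> w < 1"
  then have "m \<in> {m. \<forall>w\<in>verts D'. m \<bullet> w < 1}" by simp
  moreover have "{m. \<forall>w\<in>verts D'. m \<bullet> w < 1} \<subseteq> D" using mem_iff by force
  ultimately show "m \<in> interior D"
    using open_strict[OF finite_verts'] interiorI by blast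
next
  assume m: "m \<in> interior D"
  show "\<forall>w\<in>verts D'. m \<bullet> w < 1"
  proof
    fix w assume w: "w \<in> verts D'"
    have "w \<noteq> 0" using polar_pair.vert_nonzero[OF swap] w by blast
    obtain e where e: "e > 0" "cball m e \<subseteq> D" using m mem_interior_cball by blast
    define s where "s = e / norm w"
    have s: "s > 0" using e \<open>w \<noteq> 0\<close> by (simp add: s_def)
    have "m + s *\<^sub>R w \<in> cball m e" using e \<open>w \<noteq> 0\<close> by (simp add: s_def dist_norm)
    then have "(m + s *\<^sub>R w) \<bullet> w \<le> 1" using e w mem_iff by blast
    moreover have "s * (w \<bullet> w) > 0" using s \<open>w \<noteq> 0\<close> by simp
    ultimately show "m \<bullet> w < 1" by (simp add: inner_add_left)
  qed
qed

lemma frontier_iff: "m \<in> frontier D \<longleftrightarrow> m \<in> D \<and> (\<exists>w\<in>verts D'. m \<bullet> w = 1)"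
proof -
  have "frontier D = D - interior D"
    using polytope_imp_closed[OF polytope(1)] by (simp add: frontier_def)
  then show ?thesis
    using interior_iff[of m] mem_iff[of m] by (auto simp: less_le)
qed

lemma adjacent_exists: "v \<in> verts D \<Longrightarrow> \<exists>w. w \<in> adjacent D' v"
  using interior_iff[of v] mem_iff[of v] verts_subset extreme_point_not_in_interior[of v D]
  unfolding verts_def adjacent_def by (force simp: less_le)

text \<open>An integer that is at most 1 and different from 1 is at most 0.\<close>

lemma nonadjacent_nonpos:
  assumes "v \<in> verts D" "w \<in> verts D'" "w \<notin> adjacent D' v"
  shows "v \<bullet> w \<le> 0"
proof -
  obtain k where k: "v \<bullet> w = of_int k" using integral[OF assms(1,2)] by (auto elim: Ints_cases)
  have "v \<bullet> w \<le> 1" "v \<bullet> w \<noteq> 1" using assms verts_subset mem_iff by (auto simp: adjacent_def)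
  then have "k < 1" using k by simp
  then show ?thesis using k by simp
qed

text \<open>A point beyond the facet of \<open>w\<close> and strictly inside all other facet
  inequalities. It shows that no inequality is redundant and, after rescaling, provides points of
  the open facets.\<close>

lemma separate_vertex:
  assumes "w \<in> verts D'"
  obtains q where "q \<bullet> w > 1" "\<And>w'. w' \<in> verts D' - {w} \<Longrightarrow> q \<bullet> w' < 1"
proof -
  \<comment> \<open>Including 0 makes the separating constant \<open>b\<close> negative, so that
    dividing by \<open>b\<close> normalises it to 1 and reverses the inequalities.\<close>
  let ?C = "convex hull (insert 0 (verts D' - {w}))"
  have "?C \<subseteq> D'"
    using polar_pair.zero_in_interior[OF swap] interior_subset polar_pair.verts_subset[OF swap]
      polytope_imp_convex[OF polytope(2)] by (intro hull_minimal) auto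
  then have "w \<notin> ?C"
    using assms extreme_point_of_convex_hull[of w "insert 0 (verts D' - {w})"]
      polar_pair.vert_nonzero[OF swap assms]
    unfolding verts_def extreme_point_of_def by blast
  moreover have "closed ?C"
    using finite_verts' by (simp add: compact_imp_closed finite_imp_compact_convex_hull)
  ultimately obtain a b where ab: "a \<bullet> w < b" "\<And>x. x \<in> ?C \<Longrightarrow> a \<bullet> x > b"
    using separating_hyperplane_closed_point[of ?C w] by auto
  have "b < 0" using ab(2)[of 0] by (simp add: hull_inc)
  show ?thesis
  proof (rule that[of "a /\<^sub>R b"])
    show "(a /\<^sub>R b) \<bullet> w > 1" using ab(1) \<open>b < 0\<close> by (simp add: field_simps)
    fix w' assume "w' \<in> verts D' - {w}"
    then have "a \<bullet> w' > b" by (intro ab(2)) (simp add: hull_inc)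
    then show "(a /\<^sub>R b) \<bullet> w' < 1" using \<open>b < 0\<close> by (simp add: field_simps)
  qed
qed

text \<open>The point from \<open>separate_vertex\<close> is scaled back to the hyperplane of
  \<open>w\<close>; its pairing with \<open>w\<close> exceeds those with the other vertices, so
  these drop below 1.\<close>

lemma open_face_nonempty:
  assumes "w \<in> verts D'"
  obtains p where "p \<in> open_face D D' w"
proof -
  obtain q where q: "q \<bullet> w > 1" "\<And>w'. w' \<in> verts D' - {w} \<Longrightarrow> q \<bullet> w' < 1"
    using separate_vertex[OF assms] by blast
  define p where "p = q /\<^sub>R (q \<bullet> w)"
  have p: "p \<bullet> w = 1" using q(1) by (simp add: p_def)
  have p': "p \<bullet> w' < 1" if "w' \<in> verts D' - {w}" for w'
  proof -
    have "q \<bullet> w' < q \<bullet> w" using q(1) q(2)[OF that] by linarith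
    then show ?thesis using q(1) by (simp add: p_def field_simps)
  qed
  have "p \<bullet> w' \<le> 1" if "w' \<in> verts D'" for w'
    using p p'[of w'] that by (cases "w' = w") auto
  then have "p \<in> D" using mem_iff by blast
  then show ?thesis using that[of p] p p' by (simp add: open_face_def)
qed

section \<open>Facets and their relative interiors\<close>

lemma facet_iff: "\<sigma> facet_of D \<longleftrightarrow> (\<exists>w\<in>verts D'. \<sigma> = face_at D w)"
proof -
  define H where "H w = {m. w \<bullet> m \<le> 1}" for w :: 'a
  have sep: "\<exists>q. q \<notin> H w \<and> (\<forall>w'\<in>verts D' - {w}. q \<in> H w')" if w: "w \<in> verts D'" for w
  proof -
    obtain q where "q \<bullet> w > 1" "\<And>w'. w' \<in> verts D' - {w} \<Longrightarrow> q \<bullet> w' < 1"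
      using separate_vertex[OF w] by blast
    then show ?thesis unfolding H_def by (intro exI[of _ q]) (force simp: inner_commute less_imp_le)
  qed
  then have inj: "inj_on H (verts D')" by (intro inj_onI) blast
  \<comment> \<open>The explicit description of facets attaches a normal to each half-space as a
    set, so the label must be recovered from the half-space. This is possible since distinct labels
    give distinct half-spaces.\<close>
  define a where "a = inv_into (verts D') H"
  have a: "a (H w) = w" if "w \<in> verts D'" for w
    unfolding a_def by (rule inv_into_f_f[OF inj that])
  have aff: "affine hull D = UNIV" using affine_hull_nonempty_interior zero_in_interior by blast
  have seq: "D = affine hull D \<inter> \<Inter>(H ` verts D')"
    using mem_iff by (auto simp: aff H_def inner_commute)
  have "\<sigma> facet_of D \<longleftrightarrow> (\<exists>h. h \<in> H ` verts D' \<and> \<sigma> = D \<inter> {x. a h \<bullet> x = 1})"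
  proof (rule facet_of_polyhedron_explicit[OF _ seq])
    show "finite (H ` verts D')" using finite_verts' by simp
    show "a h \<noteq> 0 \<and> h = {x. a h \<bullet> x \<le> 1}" if "h \<in> H ` verts D'" for h
      using that a polar_pair.vert_nonzero[OF swap] by (auto simp: H_def)
    fix F' assume F': "F' \<subset> H ` verts D'"
    then obtain w where w: "w \<in> verts D'" "H w \<notin> F'" by auto
    obtain q where q: "q \<notin> H w" "\<And>w'. w'\<in>verts D' - {w} \<Longrightarrow> q \<in> H w'" using sep[OF w(1)] by blast
    have "q \<in> \<Inter>F'"
    proof
      fix h assume "h \<in> F'"
      then obtain w' where "w' \<in> verts D'" "h = H w'" using F' by blast
      then show "q \<in> h" using q(2) w(2) \<open>h \<in> F'\<close> by blast
    qed
    moreover have "q \<notin> D" using seq w(1) q(1) by blast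
    moreover have "D \<subseteq> \<Inter>F'" using seq F' by blast
    ultimately show "D \<subset> affine hull D \<inter> \<Inter>F'" by (auto simp: aff)
  qed
  also have "\<dots> \<longleftrightarrow> (\<exists>w\<in>verts D'. \<sigma> = D \<inter> {x. a (H w) \<bullet> x = 1})" by blast
  also have "\<dots> \<longleftrightarrow> (\<exists>w\<in>verts D'. \<sigma> = face_at D w)"
    using a by (auto simp: face_at_def inner_commute)
  finally show ?thesis .
qed

lemma facet_vertex_face_at:
  assumes "w \<in> verts D'"
  shows "facet_vertex D' (face_at D w) = w"
  unfolding facet_vertex_def
proof (rule the_equality)
  show "w extreme_point_of D' \<and> (\<forall>m\<in>face_at D w. m \<bullet> w = 1)"
    using assms by (simp add: verts_def face_at_def)
  fix n assume n: "n extreme_point_of D' \<and> (\<forall>m\<in>face_at D w. m \<bullet> n = 1)"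
  obtain p where "p \<in> open_face D D' w" using open_face_nonempty[OF assms] by blast
  then show "n = w" using n by (force simp: open_face_def face_at_def verts_def)
qed

text \<open>A segment from a point of the open facet can be prolonged slightly past a relative
  interior point; if that point also lay on another facet, the prolongation would violate the
  inequality of that facet. Conversely, the strict inequalities define an open set that meets the
  affine hull only inside the facet.\<close>

lemma rel_interior_face_at:
  assumes w: "w \<in> verts D'"
  shows "rel_interior (face_at D w) = open_face D D' w"
proof (intro equalityI subsetI)
  fix m assume m: "m \<in> rel_interior (face_at D w)"
  then have mf: "m \<in> D" "m \<bullet> w = 1" using rel_interior_subset by (force simp: face_at_def)+
  obtain p where p: "p \<in> open_face D D' w" using open_face_nonempty[OF w] by blast
  then have pf: "p \<in> face_at D w" by (simp add: open_face_def face_at_def)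
  have conv: "convex (face_at D w)"
    unfolding face_at_def using polytope_imp_convex[OF polytope(1)] convex_hyperplane[of w 1]
    by (simp add: convex_Int inner_commute)
  obtain e where e: "e > 1" "(1 - e) *\<^sub>R p + e *\<^sub>R m \<in> face_at D w"
    using convex_rel_interior_if[OF conv m] hull_inc[OF pf, of affine] by blast
  have "m \<bullet> w' < 1" if w': "w' \<in> verts D' - {w}" for w'
  proof (rule ccontr)
    assume "\<not> m \<bullet> w' < 1"
    then have 1: "m \<bullet> w' = 1" using mf mem_iff w' by force
    have "((1 - e) *\<^sub>R p + e *\<^sub>R m) \<bullet> w' \<le> 1" using e w' mem_iff by (auto simp: face_at_def)
    then have "(1 - e) * (p \<bullet> w') \<le> (1 - e) * 1" by (simp add: inner_add_left 1)
    then have "p \<bullet> w' \<ge> 1" using e by simp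
    then show False using p w' by (force simp: open_face_def)
  qed
  then show "m \<in> open_face D D' w" using mf by (simp add: open_face_def)
next
  fix m assume m: "m \<in> open_face D D' w"
  let ?T = "{x. \<forall>w'\<in>verts D' - {w}. x \<bullet> w' < 1}"
  have "affine hull (face_at D w) \<subseteq> {x. w \<bullet> x = 1}"
    by (intro hull_minimal affine_hyperplane) (auto simp: face_at_def inner_commute)
  then have "?T \<inter> affine hull (face_at D w) \<subseteq> face_at D w"
    using mem_iff by (force simp: face_at_def inner_commute less_imp_le)
  moreover have "open ?T" using open_strict finite_verts' by blast
  ultimately show "m \<in> rel_interior (face_at D w)"
    unfolding mem_rel_interior using m
    by (intro exI[of _ ?T]) (auto simp: open_face_def face_at_def)
qed

lemma open_face_subset_frontier: "w \<in> verts D' \<Longrightarrow> open_face D D' w \<subseteq> frontier D"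
  using frontier_iff by (auto simp: open_face_def)

lemma open_face_openin:
  assumes "w \<in> verts D'"
  shows "openin (top_of_set (frontier D)) (open_face D D' w)"
proof -
  have "open_face D D' w = frontier D \<inter> {m. \<forall>w'\<in>verts D' - {w}. m \<bullet> w' < 1}"
    using assms frontier_iff by (force simp: open_face_def)
  then show ?thesis
    using open_strict finite_verts' by auto
qed

lemma open_face_unique: "m \<in> open_face D D' w \<Longrightarrow> w' \<in> verts D' \<Longrightarrow> m \<bullet> w' = 1 \<Longrightarrow> w' = w"
  by (force simp: open_face_def)

lemma open_face_subset_star: "w \<in> adjacent D' v \<Longrightarrow> open_face D D' w \<subseteq> star D D' v"
  by (auto simp: open_face_def star_def)

text \<open>A point of \<open>U\<close> on a facet not containing \<open>v\<close> would be a limit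
  of points in the interior of that facet. These eventually lie in \<open>U\<close>, hence in the
  star, although they lie on no other facet.\<close>

lemma open_subset_star_strict:
  assumes U: "openin (top_of_set (frontier D)) U" "U \<subseteq> star D D' v" and m: "m \<in> U"
    and w: "w \<in> verts D'" "w \<notin> adjacent D' v"
  shows "m \<bullet> w < 1"
proof (rule ccontr)
  assume "\<not> m \<bullet> w < 1"
  moreover have mD: "m \<in> D" using m U by (auto simp: star_def)
  ultimately have mw: "m \<bullet> w = 1" using mem_iff w(1) by force
  obtain p where p: "p \<in> open_face D D' w" using open_face_nonempty[OF w(1)] by blast
  define q where "q n = m + (1 / real (Suc n)) *\<^sub>R (p - m)" for n
  have "q n \<in> open_face D D' w" for n
  proof -
    define t where "t = 1 / real (Suc n)"
    have t: "0 < t" "t \<le> 1" by (auto simp: t_def)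
    have qn: "q n = m + t *\<^sub>R (p - m)" by (simp only: q_def t_def)
    have q: "q n \<bullet> w' = (1 - t) * (m \<bullet> w') + t * (p \<bullet> w')" for w'
      unfolding qn by (simp add: algebra_simps)
    have q1: "q n \<bullet> w' < 1" if "w' \<in> verts D' - {w}" for w'
    proof -
      have "m \<bullet> w' \<le> 1" "p \<bullet> w' < 1" using that mD mem_iff p by (auto simp: open_face_def)
      then have "(1 - t) * (m \<bullet> w') \<le> (1 - t) * 1" "t * (p \<bullet> w') < t * 1"
        using t mult_left_mono[of _ 1 "1 - t"] by (simp_all only: mult_less_cancel_left_pos diff_ge_0_iff_ge)
      then show ?thesis unfolding q using add_le_less_mono by fastforce
    qed
    have q2: "q n \<bullet> w = 1" using p by (simp add: q mw open_face_def)
    have "q n \<bullet> w' \<le> 1" if "w' \<in> verts D'" for w'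
      using q1[of w'] q2 that by (cases "w' = w") auto
    then show ?thesis using q1 q2 mem_iff by (simp add: open_face_def)
  qed
  moreover obtain O' where O': "open O'" "U = frontier D \<inter> O'" using U(1) by (auto simp: openin_open)
  have "(\<lambda>n. inverse (real (Suc n))) \<longlonglongrightarrow> 0" by (rule LIMSEQ_inverse_real_of_nat)
  then have "(\<lambda>n. m + inverse (real (Suc n)) *\<^sub>R (p - m)) \<longlonglongrightarrow> m + 0 *\<^sub>R (p - m)"
    by (intro tendsto_intros)
  then have "q \<longlonglongrightarrow> m" by (simp add: q_def[abs_def] inverse_eq_divide)
  then have "\<forall>\<^sub>F n in sequentially. q n \<in> O'"
    using O' m by (intro topological_tendstoD) auto
  then obtain n where "q n \<in> O'" by (auto simp: eventually_sequentially)
  ultimately have "q n \<in> open_face D D' w" "q n \<in> star D D' v"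
    using O' U(2) open_face_subset_frontier[OF w(1)] by blast+
  then obtain w' where "w' \<in> adjacent D' v" "q n \<bullet> w' = 1" by (auto simp: star_def)
  then have "w' = w" using open_face_unique \<open>q n \<in> open_face D D' w\<close> by (auto simp: adjacent_def)
  then show False using w \<open>w' \<in> adjacent D' v\<close> by simp
qed

text \<open>
  On the star of \<open>v\<close>, \<open>push v\<close> recovers a point from its line in direction \<open>v\<close>; composed with a
  linear section of \<open>lattice_coords\<close> it is the inverse of a chart.
\<close>

definition push :: "'a \<Rightarrow> 'a \<Rightarrow> 'a" where
  "push v y = y + Min ((\<lambda>w. 1 - y \<bullet> w) ` adjacent D' v) *\<^sub>R v"

lemma push_le:
  assumes "w \<in> adjacent D' v"
  shows "push v y \<bullet> w \<le> 1"
proof -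
  have "Min ((\<lambda>w. 1 - y \<bullet> w) ` adjacent D' v) \<le> 1 - y \<bullet> w"
    using finite_adjacent' assms by (intro Min_le) auto
  then show ?thesis using assms by (simp add: push_def adjacent_def inner_add_left)
qed

lemma push_attained:
  assumes "v \<in> verts D"
  obtains w where "w \<in> adjacent D' v" "push v y \<bullet> w = 1"
proof -
  have "Min ((\<lambda>w. 1 - y \<bullet> w) ` adjacent D' v) \<in> (\<lambda>w. 1 - y \<bullet> w) ` adjacent D' v"
    using finite_adjacent' adjacent_exists[OF assms] by (intro Min_in) auto
  then obtain w where w: "w \<in> adjacent D' v" "Min ((\<lambda>w. 1 - y \<bullet> w) ` adjacent D' v) = 1 - y \<bullet> w" by blast
  then show ?thesis using that[of w] by (simp add: push_def adjacent_def inner_add_left)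
qed

text \<open>Along direction \<open>v\<close> all adjacent pairings grow at unit rate, so a line
  meets the boundary of the cone of adjacent inequalities exactly once.\<close>

lemma push_unique:
  assumes "v \<in> verts D" "\<And>w. w \<in> adjacent D' v \<Longrightarrow> (y + t *\<^sub>R v) \<bullet> w \<le> 1"
    "w \<in> adjacent D' v" "(y + t *\<^sub>R v) \<bullet> w = 1"
  shows "push v y = y + t *\<^sub>R v"
proof -
  define s where "s = Min ((\<lambda>w. 1 - y \<bullet> w) ` adjacent D' v)"
  have p: "push v y = y + s *\<^sub>R v" by (simp add: push_def s_def)
  have e: "(y + r *\<^sub>R v) \<bullet> u = y \<bullet> u + r" if "u \<in> adjacent D' v" for r u
    using that by (simp add: adjacent_def inner_add_left)
  obtain u where u: "u \<in> adjacent D' v" "push v y \<bullet> u = 1" using push_attained[OF assms(1)] by blast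
  have "t \<le> s" using assms(2)[OF u(1)] u e[OF u(1)] by (simp add: p)
  moreover have "s \<le> t" using assms(3,4) push_le[OF assms(3), of y] e[OF assms(3)] by (simp add: p)
  ultimately show ?thesis by (simp add: p)
qed

lemma push_translate: "v \<in> verts D \<Longrightarrow> push v (y + s *\<^sub>R v) = push v y"
proof -
  assume v: "v \<in> verts D"
  define r where "r = Min ((\<lambda>w. 1 - y \<bullet> w) ` adjacent D' v)"
  have p: "push v y = y + r *\<^sub>R v" by (simp add: push_def r_def)
  have e: "y + s *\<^sub>R v + (r - s) *\<^sub>R v = push v y" by (simp add: p algebra_simps)
  obtain u where u: "u \<in> adjacent D' v" "push v y \<bullet> u = 1" using push_attained[OF v] by blast
  show ?thesis
    using push_unique[OF v, of "y + s *\<^sub>R v" "r - s" u] u push_le[of _ v y] unfolding e by simp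
qed

lemma push_star: "v \<in> verts D \<Longrightarrow> m \<in> star D D' v \<Longrightarrow> push v m = m"
  using push_unique[of v m 0] mem_iff by (force simp: star_def adjacent_def)

lemma continuous_push:
  assumes "v \<in> verts D" shows "continuous_on UNIV (push v)"
proof -
  have c: "continuous_on UNIV (\<lambda>y::'a. Min ((\<lambda>w. 1 - y \<bullet> w) ` A))" if "finite A" "A \<noteq> {}" for A
    using that
  proof (induction A rule: finite_ne_induct)
    case (singleton w)
    then show ?case by (auto intro!: continuous_intros)
  next
    case (insert w A)
    then show ?case by (auto intro!: continuous_intros simp: Min_insert)
  qed
  show ?thesis
    unfolding push_def[abs_def] using finite_adjacent' adjacent_exists[OF assms]
    by (intro continuous_intros c) auto
qed

end

section \<open>Coordinates modulo a vertex and charts on its star\<close>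

definition perp_basis :: "'a::euclidean_space \<Rightarrow> ('d::finite \<Rightarrow> 'a) \<Rightarrow> bool" where
  "perp_basis v \<beta> \<longleftrightarrow> (\<forall>i. v \<bullet> \<beta> i = 0) \<and>
     (\<forall>n. v \<bullet> n = 0 \<longrightarrow> (\<exists>\<xi>::real^'d. n = (\<Sum>i\<in>UNIV. \<xi> $ i *\<^sub>R \<beta> i)))"

lemma linear_lattice_coords: "linear (lattice_coords \<beta>)"
  by (rule linearI) (auto simp: lattice_coords_def vec_eq_iff inner_add_left)

lemma inner_lincomb_lattice_coords:
  "m \<bullet> (\<Sum>i\<in>UNIV. \<xi> $ i *\<^sub>R \<beta> i) = lattice_coords \<beta> m \<bullet> \<xi>"
  by (simp add: inner_sum_right lattice_coords_def inner_vec_def mult.commute)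

text \<open>The coordinates form the adjoint of the map \<open>B\<close> that combines the vectors
  \<beta>. These span a hyperplane of dimension \<open>CARD('d)\<close>, so \<open>B\<close> is
  injective and its adjoint surjective. The kernel of the coordinates is the line through
  \<open>v\<close>.\<close>

lemma lattice_coords_section:
  fixes \<beta> :: "'d::finite \<Rightarrow> 'a::euclidean_space"
  assumes "perp_basis v \<beta>" "v \<noteq> 0" "DIM('a) = CARD('d) + 1"
  obtains L :: "real^'d \<Rightarrow> 'a" where "linear L" "\<And>x. lattice_coords \<beta> (L x) = x"
    "\<And>m. \<exists>s. L (lattice_coords \<beta> m) = m + s *\<^sub>R v"
proof -
  define B where "B \<xi> = (\<Sum>i\<in>UNIV. \<xi> $ i *\<^sub>R \<beta> i)" for \<xi> :: "real^'d"
  have B: "linear B"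
    by (rule linearI) (auto simp: B_def algebra_simps sum.distrib scaleR_sum_right)
  have "range B = {n. v \<bullet> n = 0}"
    using assms(1) by (auto simp: B_def perp_basis_def inner_sum_right)
  then have "dim (range B) = CARD('d)"
    using dim_hyperplane[OF assms(2)] assms(3) by simp
  then have "dim (range B) = dim (UNIV :: (real^'d) set)" by simp
  \<comment> \<open>Identifying the range of \<open>B\<close> with the coordinate space turns
    \<open>B\<close> into a surjective endomorphism, which is therefore injective.\<close>
  then obtain f :: "'a \<Rightarrow> real^'d" where f: "linear f" "f ` range B = UNIV"
    using isometries_subspaces[OF linear_subspace_image[OF B subspace_UNIV] subspace_UNIV] by metis
  then have "inj (f \<circ> B)"
    using linear_surj_imp_inj[OF linear_compose[OF B f(1)]] by (simp add: image_comp)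
  then have "inj B" by (rule inj_on_imageI2)
  moreover have "adjoint B = lattice_coords \<beta>"
    by (rule adjoint_unique) (simp add: B_def inner_lincomb_lattice_coords inner_commute)
  ultimately have "surj (lattice_coords \<beta>)"
    using surj_adjoint_iff_inj[OF B] by simp
  then obtain L where L: "linear L" "lattice_coords \<beta> \<circ> L = id"
    using linear_surjective_right_inverse[OF linear_lattice_coords] by blast
  have Lx: "lattice_coords \<beta> (L x) = x" for x using L(2) by (metis comp_apply id_apply)
  show ?thesis
  proof (rule that[OF L(1) Lx])
    fix m
    define z where "z = L (lattice_coords \<beta> m) - m"
    define s where "s = (v \<bullet> z) / (v \<bullet> v)"
    have "lattice_coords \<beta> z = 0"
      by (simp add: z_def linear_diff[OF linear_lattice_coords] Lx)
    then have zn: "z \<bullet> n = 0" if "v \<bullet> n = 0" for n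
      using assms(1) that inner_lincomb_lattice_coords[of z _ \<beta>] by (auto simp: perp_basis_def)
    have vz: "v \<bullet> (z - s *\<^sub>R v) = 0" using assms(2) by (simp add: s_def inner_diff_right)
    then have "(z - s *\<^sub>R v) \<bullet> (z - s *\<^sub>R v) = 0"
      using zn[OF vz] by (simp add: inner_diff_left)
    then have "z = s *\<^sub>R v" unfolding inner_eq_zero_iff by simp
    then show "\<exists>s. L (lattice_coords \<beta> m) = m + s *\<^sub>R v"
      unfolding z_def by (metis add.commute diff_add_cancel)
  qed
qed

text \<open>A section recovers a point up to a multiple of \<open>v\<close>, and the equation of the
  facet fixes that multiple because \<open>v \<bullet> w = 1\<close>.\<close>

lemma affine_on_facet:
  fixes \<beta> :: "'d::finite \<Rightarrow> 'a::euclidean_space"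
  assumes "perp_basis v \<beta>" "v \<noteq> 0" "DIM('a) = CARD('d) + 1" "v \<bullet> w = 1"
  obtains K :: "real^'d \<Rightarrow> 'a" where "linear K" "\<And>m. m \<bullet> w = 1 \<Longrightarrow> m = K (lattice_coords \<beta> m) + v"
proof -
  obtain L :: "real^'d \<Rightarrow> 'a" where L: "linear L" "\<And>x. lattice_coords \<beta> (L x) = x"
    "\<And>m. \<exists>s. L (lattice_coords \<beta> m) = m + s *\<^sub>R v"
    using lattice_coords_section[OF assms(1-3)] by blast
  define K where "K x = L x - (L x \<bullet> w) *\<^sub>R v" for x
  show ?thesis
  proof (rule that[of K])
    show "linear K"
      by (rule linearI) (auto simp: K_def linear_add[OF L(1)] linear_cmul[OF L(1)] algebra_simps)
    fix m assume m: "m \<bullet> w = 1"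
    obtain s where s: "L (lattice_coords \<beta> m) = m + s *\<^sub>R v" using L(3) by blast
    show "m = K (lattice_coords \<beta> m) + v"
      by (simp add: K_def s inner_add_left m assms(4) algebra_simps)
  qed
qed

context polar_pair
begin

text \<open>The inverse is \<open>push v\<close> after a linear section. The image of
  \<open>U\<close> is a preimage under this continuous map, so it is open once \<open>U\<close> is
  cut out by open conditions.\<close>

lemma star_chart:
  fixes \<beta> :: "'d::finite \<Rightarrow> 'a"
  assumes v: "v \<in> verts D" and \<beta>: "perp_basis v \<beta>" "DIM('a) = CARD('d) + 1"
    and U: "openin (top_of_set (frontier D)) U" "U \<subseteq> star D D' v"
  shows "open (lattice_coords \<beta> ` U)"
    and "inj_on (lattice_coords \<beta>) U"
    and "homeomorphism U (lattice_coords \<beta> ` U) (lattice_coords \<beta>) (inv_into U (lattice_coords \<beta>))"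
proof -
  obtain L :: "real^'d \<Rightarrow> 'a" where L: "linear L" "\<And>x. lattice_coords \<beta> (L x) = x"
    "\<And>m. \<exists>s. L (lattice_coords \<beta> m) = m + s *\<^sub>R v"
    using lattice_coords_section[OF \<beta>(1) vert_nonzero[OF v] \<beta>(2)] by blast
  have qL: "push v (L (lattice_coords \<beta> m)) = m" if "m \<in> U" for m
    using L(3)[of m] push_translate[OF v] push_star[OF v] that U(2) by (metis subsetD)
  show inj: "inj_on (lattice_coords \<beta>) U"
    by (rule inj_on_inverseI[of _ "\<lambda>x. push v (L x)"]) (rule qL)
  have coords_push: "lattice_coords \<beta> (push v (L x)) = x" for x
    using \<beta>(1) L(2)[of x]
    by (simp add: push_def lattice_coords_def perp_basis_def inner_add_left vec_eq_iff)
  have cont: "continuous_on S (\<lambda>x. push v (L x))" for S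
    using continuous_on_compose2[OF continuous_push[OF v] linear_continuous_on] L(1)
    by (simp add: linear_conv_bounded_linear)
  obtain O' where O': "open O'" "U = frontier D \<inter> O'" using U(1) by (auto simp: openin_open)
  \<comment> \<open>After \<open>push v\<close> the adjacent inequalities hold automatically. The
    remaining ones may be taken strict by \<open>open_subset_star_strict\<close>, which makes the
    set open.\<close>
  let ?N = "O' \<inter> {y. \<forall>w\<in>verts D' - adjacent D' v. y \<bullet> w < 1}"
  have img: "lattice_coords \<beta> ` U = (\<lambda>x. push v (L x)) -` ?N"
  proof (intro equalityI subsetI)
    fix x assume "x \<in> lattice_coords \<beta> ` U"
    then obtain m where m: "m \<in> U" "x = lattice_coords \<beta> m" by blast
    then show "x \<in> (\<lambda>x. push v (L x)) -` ?N"
      using qL[OF m(1)] O' open_subset_star_strict[OF U m(1)] by simp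
  next
    fix x assume x: "x \<in> (\<lambda>x. push v (L x)) -` ?N"
    let ?m = "push v (L x)"
    have "?m \<bullet> w \<le> 1" if "w \<in> verts D'" for w
      using push_le[of w v "L x"] x that by (cases "w \<in> adjacent D' v") (auto simp: less_imp_le)
    moreover obtain w where "w \<in> adjacent D' v" "?m \<bullet> w = 1" using push_attained[OF v] by blast
    ultimately have "?m \<in> frontier D" using frontier_iff mem_iff by (auto simp: adjacent_def)
    then have "?m \<in> U" using x O' by simp
    then show "x \<in> lattice_coords \<beta> ` U" using coords_push[of x] by force
  qed
  have "open ?N" using O' finite_verts' by (intro open_Int open_strict) auto
  then show "open (lattice_coords \<beta> ` U)"
    unfolding img by (rule open_vimage[OF _ cont])
  have inv: "inv_into U (lattice_coords \<beta>) x = push v (L x)" if "x \<in> lattice_coords \<beta> ` U" for x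
    using that qL inj by auto
  have "continuous_on (lattice_coords \<beta> ` U) (inv_into U (lattice_coords \<beta>))"
    using cont by (subst continuous_on_cong[OF refl inv]) auto
  then show "homeomorphism U (lattice_coords \<beta> ` U) (lattice_coords \<beta>) (inv_into U (lattice_coords \<beta>))"
    using inj linear_lattice_coords[of \<beta>]
    by (intro homeomorphismI) (auto intro!: linear_continuous_on simp: linear_conv_bounded_linear inv_into_into)
qed

end

section \<open>Lattices and reflexive polytopes\<close>

text \<open>The closure property has the shape of the map that moves lattice vectors into the
  orthogonal complement of \<open>v\<close>.\<close>

definition int_closed :: "'a::real_vector set \<Rightarrow> bool" where
  "int_closed L \<longleftrightarrow> (\<forall>x\<in>L. \<forall>y\<in>L. \<forall>p q. of_int p *\<^sub>R x - of_int q *\<^sub>R y \<in> L)"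

text \<open>
  If \<open>v\<close> is integral on \<open>L\<close> and \<open>c = v \<bullet> f \<noteq> 0\<close> for some \<open>f \<in> L\<close>, then \<open>x \<mapsto> c x - (v \<bullet> x) f\<close> maps
  \<open>L\<close> into \<open>L \<inter> v\<^sup>\<bottom>\<close> and is multiplication by \<open>c\<close> on \<open>v\<^sup>\<bottom>\<close>; hence \<open>L \<inter> v\<^sup>\<bottom>\<close> spans \<open>v\<^sup>\<bottom>\<close>.
\<close>

lemma generates_lattice_perp_basis:
  fixes \<beta> :: "'d::finite \<Rightarrow> 'a::euclidean_space"
  assumes L: "int_closed L" "span L = UNIV" and v: "v \<noteq> 0" "\<And>l. l \<in> L \<Longrightarrow> v \<bullet> l \<in> \<int>"
    and gen: "generates_lattice \<beta> (L \<inter> {n. v \<bullet> n = 0})"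
  shows "perp_basis v \<beta>"
  unfolding perp_basis_def
proof (intro conjI allI impI)
  fix i
  have "(\<Sum>j\<in>UNIV. of_int (if j = i then 1 else 0) *\<^sub>R \<beta> j) = (\<Sum>j\<in>UNIV. if j = i then \<beta> j else 0)"
    by (intro sum.cong) auto
  also have "\<dots> = \<beta> i" by simp
  finally have "\<beta> i \<in> L \<inter> {n. v \<bullet> n = 0}"
    using gen unfolding generates_lattice_def
    by (simp only:) (rule image_eqI[where x = "\<lambda>j. if j = i then 1 else 0"], rule sym, assumption, rule UNIV_I)
  then show "v \<bullet> \<beta> i = 0" by simp
next
  fix n assume n: "v \<bullet> n = 0"
  define B where "B \<xi> = (\<Sum>i\<in>UNIV. \<xi> $ i *\<^sub>R \<beta> i)" for \<xi> :: "real^'d"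
  have B: "linear B"
    by (rule linearI) (auto simp: B_def algebra_simps sum.distrib scaleR_sum_right)
  have sub: "L \<inter> {n. v \<bullet> n = 0} \<subseteq> range B"
  proof
    fix x assume "x \<in> L \<inter> {n. v \<bullet> n = 0}"
    then obtain k :: "'d \<Rightarrow> int" where "x = (\<Sum>i\<in>UNIV. of_int (k i) *\<^sub>R \<beta> i)"
      using gen unfolding generates_lattice_def by auto
    then have "x = B (\<chi> i. of_int (k i))" by (simp add: B_def)
    then show "x \<in> range B" by blast
  qed
  \<comment> \<open>A lattice spanning the space cannot lie in one hyperplane.\<close>
  obtain f where f: "f \<in> L" "v \<bullet> f \<noteq> 0"
  proof -
    have "\<not> span L \<subseteq> {x. v \<bullet> x = 0}" using L(2) v(1) inner_eq_zero_iff by blast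
    then show ?thesis using that span_minimal[OF _ subspace_hyperplane] by blast
  qed
  define T where "T x = (v \<bullet> f) *\<^sub>R x - (v \<bullet> x) *\<^sub>R f" for x
  have T: "linear T" by (rule linearI) (auto simp: T_def algebra_simps)
  have "T ` L \<subseteq> range B"
  proof
    fix y assume "y \<in> T ` L"
    then obtain x where x: "x \<in> L" "y = T x" by blast
    obtain p q where "v \<bullet> f = of_int p" "v \<bullet> x = of_int q" using v(2) f x by (metis Ints_cases)
    then have "y \<in> L" using L(1) f x unfolding int_closed_def T_def by simp
    moreover have "v \<bullet> y = 0" by (simp add: x(2) T_def inner_diff_right)
    ultimately show "y \<in> range B" using sub by blast
  qed
  then have "span (T ` L) \<subseteq> range B"
    using span_minimal linear_subspace_image[OF B subspace_UNIV] by blast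
  moreover have "T n \<in> span (T ` L)" using linear_span_image[OF T, of L] L(2) by simp
  ultimately obtain \<xi> where "T n = B \<xi>" by blast
  then have "(v \<bullet> f) *\<^sub>R n = B \<xi>" by (simp add: T_def n)
  then have "n = B (\<xi> /\<^sub>R (v \<bullet> f))" using f(2) by (simp add: linear_cmul[OF B]) (metis scaleR_left_imp_eq scaleR_scaleR right_inverse scaleR_one)
  then show "\<exists>\<xi>::real^'d. n = (\<Sum>i\<in>UNIV. \<xi> $ i *\<^sub>R \<beta> i)" unfolding B_def by blast
qed

section \<open>Full lattices and their duals\<close>

lemma full_lattice_int_closed: "full_lattice M \<Longrightarrow> int_closed M"
  unfolding int_closed_def
proof (intro ballI allI)
  fix x y p q assume "full_lattice M" "x \<in> M" "y \<in> M"
  then obtain E k l where M: "M = range (\<lambda>k :: 'a \<Rightarrow> int. \<Sum>e\<in>E. of_int (k e) *\<^sub>R e)"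
    and x: "x = (\<Sum>e\<in>E. of_int (k e) *\<^sub>R e)" and y: "y = (\<Sum>e\<in>E. of_int (l e) *\<^sub>R e)"
    unfolding full_lattice_def by auto
  have eq: "of_int p *\<^sub>R x - of_int q *\<^sub>R y = (\<Sum>e\<in>E. of_int (p * k e - q * l e) *\<^sub>R e)"
    by (simp add: x y scaleR_sum_right sum_subtractf scaleR_diff_left)
  show "of_int p *\<^sub>R x - of_int q *\<^sub>R y \<in> M"
    unfolding M by (rule image_eqI[where x = "\<lambda>e. p * k e - q * l e", OF _ UNIV_I]) (rule eq)
qed

lemma full_lattice_basis_subset:
  assumes "independent E" "M = range (\<lambda>k :: 'a::euclidean_space \<Rightarrow> int. \<Sum>e\<in>E. of_int (k e) *\<^sub>R e)"
  shows "E \<subseteq> M"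
proof
  fix e assume "e \<in> E"
  then have "(\<Sum>e'\<in>E. of_int (if e' = e then 1 else 0) *\<^sub>R e') = (\<Sum>e'\<in>E. if e' = e then e' else 0)"
    by (intro sum.cong) auto
  also have "\<dots> = e" using \<open>e \<in> E\<close> independent_imp_finite[OF assms(1)] by simp
  finally show "e \<in> M" unfolding assms(2)
    by (intro image_eqI[where x = "\<lambda>e'. if e' = e then 1 else 0"]) (rule sym, assumption, rule UNIV_I)
qed

lemma full_lattice_span:
  assumes "full_lattice M" shows "span M = UNIV"
proof -
  obtain E where E: "independent E" "span E = UNIV"
    "M = range (\<lambda>k :: 'a \<Rightarrow> int. \<Sum>e\<in>E. of_int (k e) *\<^sub>R e)"
    using assms unfolding full_lattice_def by blast
  then show ?thesis using span_mono[OF full_lattice_basis_subset[OF E(1,3)]] by auto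
qed

lemma dual_lattice_int_closed: "int_closed (dual_lattice M)"
  unfolding int_closed_def dual_lattice_def by (auto simp: inner_diff_right)

text \<open>The dual lattice contains the dual basis.\<close>

lemma dual_lattice_span:
  fixes M :: "'a::euclidean_space set"
  assumes "full_lattice M" shows "span (dual_lattice M) = UNIV"
proof (rule ccontr)
  obtain E where E: "independent E" "span E = UNIV"
    "M = range (\<lambda>k :: 'a \<Rightarrow> int. \<Sum>e\<in>E. of_int (k e) *\<^sub>R e)"
    using assms unfolding full_lattice_def by blast
  note fin = independent_imp_finite[OF E(1)]
  have "\<exists>n. \<forall>e'\<in>E. e' \<bullet> n = (if e' = e then 1 else 0)" for e
  proof -
    obtain f :: "'a \<Rightarrow> real" where f: "linear f" "\<forall>e'\<in>E. f e' = (if e' = e then 1 else 0)"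
      using linear_independent_extend[OF E(1), of "\<lambda>e'. if e' = e then 1 else 0 :: real"] by auto
    have "x \<bullet> adjoint f 1 = f x" for x using adjoint_works[OF f(1), of x 1] by simp
    then show ?thesis using f(2) by (intro exI[of _ "adjoint f 1"]) simp
  qed
  then obtain d where d: "\<And>e e'. e' \<in> E \<Longrightarrow> e' \<bullet> d e = (if e' = e then 1 else 0)" by metis
  have dN: "d e \<in> dual_lattice M" if "e \<in> E" for e
    unfolding dual_lattice_def
  proof (intro CollectI ballI)
    fix m assume "m \<in> M"
    then obtain k :: "'a \<Rightarrow> int" where m: "m = (\<Sum>e\<in>E. of_int (k e) *\<^sub>R e)" unfolding E(3) by auto
    have "m \<bullet> d e = (\<Sum>e'\<in>E. of_int (k e') * (e' \<bullet> d e))" by (simp add: m inner_sum_left)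
    also have "\<dots> = (\<Sum>e'\<in>E. if e' = e then of_int (k e') else 0)" by (intro sum.cong) (auto simp: d)
    finally show "m \<bullet> d e \<in> \<int>" by (simp add: fin)
  qed
  assume "span (dual_lattice M) \<noteq> UNIV"
  then obtain a where a: "a \<noteq> 0" "span (dual_lattice M) \<subseteq> {x. a \<bullet> x = 0}"
    using span_not_univ_subset_hyperplane by blast
  have "a \<in> span E" using E(2) by simp
  then obtain c where c: "a = (\<Sum>e\<in>E. c e *\<^sub>R e)" using span_finite[OF fin] by auto
  \<comment> \<open>Pairing with \<open>d e\<close> reads off the coefficient of \<open>e\<close>,
    while \<open>a\<close> is orthogonal to every \<open>d e\<close>.\<close>
  have "c e = 0" if "e \<in> E" for e
  proof -
    have "a \<bullet> d e = (\<Sum>e'\<in>E. c e' * (e' \<bullet> d e))" by (simp add: c inner_sum_left)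
    also have "\<dots> = (\<Sum>e'\<in>E. if e' = e then c e' else 0)" by (intro sum.cong) (auto simp: d)
    finally have "a \<bullet> d e = c e" using that by (simp add: fin)
    then show ?thesis using a(2) dN[OF that] span_base by force
  qed
  then show False using a(1) c by simp
qed

section \<open>From reflexive polytopes to polar pairs\<close>

lemma verts_lattice_polytope: "lattice_polytope M D \<Longrightarrow> verts D \<subseteq> M"
  unfolding lattice_polytope_def verts_def using extreme_point_of_convex_hull by auto

lemma lattice_polytope_imp_polytope: "lattice_polytope M D \<Longrightarrow> polytope D"
  by (auto simp: lattice_polytope_def polytope_def)

text \<open>The bipolar theorem requires 0 to lie in \<open>D\<close>. Otherwise a hyperplane
  separating 0 from \<open>D\<close> would give a ray in the dual, contradicting
  boundedness.\<close>

lemma dual_dual_polytope: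
  fixes D :: "'a::euclidean_space set"
  assumes "polytope D" "bounded (dual_polytope D)"
  shows "dual_polytope (dual_polytope D) = D"
proof
  show "D \<subseteq> dual_polytope (dual_polytope D)" by (auto simp: dual_polytope_def inner_commute)
  note sep = separating_hyperplane_closed_point[OF polytope_imp_convex[OF assms(1)]
      polytope_imp_closed[OF assms(1)]]
  obtain R where R: "\<And>n. n \<in> dual_polytope D \<Longrightarrow> norm n \<le> R" using assms(2) by (auto simp: bounded_iff)
  have 0: "0 \<in> D"
  proof (rule ccontr)
    assume "0 \<notin> D"
    then obtain a b where ab: "0 < b" "\<And>x. x \<in> D \<Longrightarrow> a \<bullet> x > b" using sep[of 0] by auto
    have far: "norm (t *\<^sub>R z) \<le> R" if "t \<ge> 0" "\<And>x. x \<in> D \<Longrightarrow> z \<bullet> x \<le> 0" for t z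
    proof (rule R)
      have "t * (x \<bullet> z) \<le> 0" if "x \<in> D" for x
        using \<open>t \<ge> 0\<close> that \<open>\<And>x. x \<in> D \<Longrightarrow> z \<bullet> x \<le> 0\<close> by (simp add: mult_nonneg_nonpos inner_commute)
      then show "t *\<^sub>R z \<in> dual_polytope D" by (force simp: dual_polytope_def)
    qed
    obtain z :: 'a where z: "z \<noteq> 0" "\<And>x. x \<in> D \<Longrightarrow> z \<bullet> x \<le> 0"
    proof (cases "D = {}")
      case True
      then show ?thesis using that[of "SOME i. i \<in> Basis"] by (metis SOME_Basis empty_iff nonzero_Basis)
    next
      case False
      then obtain x where "x \<in> D" by blast
      then have "a \<noteq> 0" using ab by force
      then show ?thesis using that[of "- a"] ab by force
    qed
    have "norm (((\<bar>R\<bar> + 1) / norm z) *\<^sub>R z) = \<bar>R\<bar> + 1" using z(1) by simp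
    then show False using far[of "(\<bar>R\<bar> + 1) / norm z" z] z(2) by auto
  qed
  show "dual_polytope (dual_polytope D) \<subseteq> D"
  proof (rule ccontr)
    assume "\<not> dual_polytope (dual_polytope D) \<subseteq> D"
    then obtain y where y: "y \<in> dual_polytope (dual_polytope D)" "y \<notin> D" by blast
    obtain a b where ab: "a \<bullet> y < b" "\<And>x. x \<in> D \<Longrightarrow> a \<bullet> x > b" using sep[OF y(2)] by auto
    \<comment> \<open>This sign allows the separating functional to be rescaled into the dual
      polytope, where it contradicts the choice of \<open>y\<close>.\<close>
    have b: "b < 0" using ab(2)[OF 0] by simp
    have "a /\<^sub>R b \<in> dual_polytope D"
      unfolding dual_polytope_def
    proof (intro CollectI ballI)
      fix x assume "x \<in> D"
      then show "x \<bullet> (a /\<^sub>R b) \<le> 1" using ab(2)[of x] b by (simp add: inner_commute field_simps)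
    qed
    then have "(a /\<^sub>R b) \<bullet> y \<le> 1" using y(1) unfolding dual_polytope_def[of "dual_polytope D"] by blast
    then show False using ab(1) b by (simp add: field_simps)
  qed
qed

lemma reflexive_polar_pair:
  assumes "reflexive_polytope M D"
  shows "polar_pair D (dual_polytope D)"
proof
  have l: "lattice_polytope M D" "lattice_polytope (dual_lattice M) (dual_polytope D)"
    using assms by (auto simp: reflexive_polytope_def)
  show p: "polytope D" "polytope (dual_polytope D)" using l lattice_polytope_imp_polytope by blast+
  show "D = dual_polytope (dual_polytope D)"
    using dual_dual_polytope[OF p(1) polytope_imp_bounded[OF p(2)]] by simp
  show "v \<bullet> w \<in> \<int>" if "v \<in> verts D" "w \<in> verts (dual_polytope D)" for v w
    using that l verts_lattice_polytope unfolding dual_lattice_def by blast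
qed simp

section \<open>The induced Hessian structures\<close>

text \<open>
  The matrix \<open>P\<close>. Here \<open>u = z = 0\<close> unless both charts live on open facets \<open>\<sigma>\<^sup>\<circ>\<close> and \<open>\<tau>\<^sup>\<circ>\<close>, in which case
  \<open>u = m\<^sub>\<tau>\<close> and \<open>z = n\<^sub>\<sigma>\<close>.
\<close>

definition coupling :: "('d \<Rightarrow> 'a::real_inner) \<Rightarrow> ('d \<Rightarrow> 'a) \<Rightarrow> 'a \<Rightarrow> 'a \<Rightarrow> 'd \<Rightarrow> 'd \<Rightarrow> real" where
  "coupling \<beta> \<beta>' u z j i = \<beta>' j \<bullet> \<beta> i - (u \<bullet> \<beta> i) * (\<beta>' j \<bullet> z)"

text \<open>The correction term is a product of one factor per chart, so exchanging the charts
  transposes it.\<close>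

lemma coupling_transpose: "(\<lambda>i j. coupling \<beta> \<beta>' u z j i) = coupling \<beta>' \<beta> z u"
  by (intro ext) (simp add: coupling_def inner_commute mult.commute)

text \<open>Instead of convexity of \<Phi> and the formula for \<Psi>, the locale assumes
  consequences that hold for both functions; this gives \<open>mirror_swap\<close>.\<close>

locale mirror = polar_pair D D' for D D' :: "'a::euclidean_space set" +
  fixes \<Phi> \<Psi> :: "'a \<Rightarrow> real" and F G :: "'a \<Rightarrow> 'a" and b b' :: "'a set \<Rightarrow> 'd::finite \<Rightarrow> 'a"
  assumes dim: "DIM('a) = CARD('d) + 1"
    and homeo: "homeomorphism (frontier D) (frontier D') F G"
    and duality: "\<And>m n. m \<in> frontier D \<Longrightarrow> n \<in> frontier D' \<Longrightarrow> m \<bullet> n \<le> \<Phi> m + \<Psi> n"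
    and contact: "\<And>m n. m \<in> frontier D \<Longrightarrow> n \<in> frontier D' \<Longrightarrow> \<Phi> m + \<Psi> n = m \<bullet> n \<longleftrightarrow> n = F m"
    and growth: "\<And>m v s. v \<in> D \<Longrightarrow> 0 \<le> s \<Longrightarrow> \<Phi> (m + s *\<^sub>R v) \<le> \<Phi> m + s"
    and growth': "\<And>n w s. w \<in> D' \<Longrightarrow> 0 \<le> s \<Longrightarrow> \<Psi> (n + s *\<^sub>R w) \<le> \<Psi> n + s"
    and basis: "\<And>v. v \<in> verts D \<Longrightarrow> perp_basis v (b (face_at D' v))"
    and basis': "\<And>w. w \<in> verts D' \<Longrightarrow> perp_basis w (b' (face_at D w))"
    and smooth: "smooth_potentials (induced_atlas D D' \<Phi> \<Psi> b)"
    and smooth': "smooth_potentials (induced_atlas D' D \<Psi> \<Phi> b')"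
begin

lemma F_in: "m \<in> frontier D \<Longrightarrow> F m \<in> frontier D'"
  and G_in: "n \<in> frontier D' \<Longrightarrow> G n \<in> frontier D"
  and GF: "m \<in> frontier D \<Longrightarrow> G (F m) = m"
  and FG: "n \<in> frontier D' \<Longrightarrow> F (G n) = n"
  using homeo by (auto simp: homeomorphism_def)

lemma mirror_swap: "mirror D' D \<Psi> \<Phi> G F b' b"
proof (rule mirror.intro[OF swap], unfold_locales)
  fix n m assume n: "n \<in> frontier D'" and m: "m \<in> frontier D"
  show "n \<bullet> m \<le> \<Psi> n + \<Phi> m" using duality[OF m n] by (simp add: inner_commute add.commute)
  show "\<Psi> n + \<Phi> m = n \<bullet> m \<longleftrightarrow> m = G n"
    using contact[OF m n] GF[OF m] FG[OF n] by (auto simp: inner_commute add.commute)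
qed (use dim homeomorphism_symD[OF homeo] growth growth' basis basis' smooth smooth' in auto)

section \<open>The two kinds of charts\<close>

abbreviation atlas :: "('a, 'd) hchart set" where
  "atlas \<equiv> induced_atlas D D' \<Phi> \<Psi> b"

definition coords :: "'a \<Rightarrow> 'a \<Rightarrow> real^'d" where
  "coords v = lattice_coords (b (face_at D' v))"

text \<open>This is U_\<tau> for the dual facet \<tau> with vertex \<open>v\<close>, as a preimage
  under \<open>F\<close>.\<close>

definition vertex_dom :: "'a \<Rightarrow> 'a set" where
  "vertex_dom v = {m \<in> frontier D. F m \<in> open_face D' D v}"

text \<open>The condition \<open>n \<bullet> v = 1\<close> makes both \<open>F m - n\<close> and the
  difference of two admissible \<open>n\<close> orthogonal to \<open>v\<close>, hence expressible in
  the chosen generators.\<close>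

definition vertex_chart :: "'a \<Rightarrow> 'a \<Rightarrow> ('a, 'd) hchart \<Rightarrow> bool" where
  "vertex_chart v n c \<longleftrightarrow> v \<in> verts D \<and> n \<bullet> v = 1 \<and> c = (vertex_dom v, coords v, \<lambda>m. \<Phi> m - m \<bullet> n)"

definition facet_chart :: "'a \<Rightarrow> 'a \<Rightarrow> ('a, 'd) hchart \<Rightarrow> bool" where
  "facet_chart v w c \<longleftrightarrow> v \<in> verts D \<and> w \<in> adjacent D' v \<and> c = (open_face D D' w, coords v, \<Phi>)"

text \<open>What both kinds of charts share, and what \<open>star_chart\<close> consumes.\<close>

definition chart_at :: "'a \<Rightarrow> ('a, 'd) hchart \<Rightarrow> bool" where
  "chart_at v c \<longleftrightarrow> v \<in> verts D \<and> chart_map c = coords v \<and>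
     openin (top_of_set (frontier D)) (chart_dom c) \<and> chart_dom c \<subseteq> star D D' v"

lemma vertex_chart_dom_eq:
  assumes "v \<in> verts D"
  shows "vertex_chart_dom D D' \<Phi> \<Psi> (face_at D' v) = vertex_dom v"
proof -
  have c: "c_gradient D' D \<Psi> \<Phi> n = {G n}" if "n \<in> frontier D'" for n
    using that contact[OF _ that] G_in[OF that] GF FG[OF that]
    by (auto simp: c_gradient_def inner_commute[of n] add.commute[of "\<Psi> n"])
  have "vertex_chart_dom D D' \<Phi> \<Psi> (face_at D' v) =
      frontier D - G ` (frontier D' - open_face D' D v)"
    unfolding vertex_chart_dom_def polar_pair.rel_interior_face_at[OF swap assms] using c by auto
  also have "\<dots> = vertex_dom v"
    unfolding vertex_dom_def using F_in GF FG by force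
  finally show ?thesis .
qed

text \<open>
  If \<open>m\<close> lay in no facet containing \<open>v\<close>, then by integrality \<open>v\<close> would be nonpositive on all
  facets through \<open>m\<close>, and \<open>push v m = m + s v\<close> would be a second boundary point in contact with \<open>F m\<close>.
\<close>

lemma contact_in_star:
  assumes v: "v \<in> verts D" and m: "m \<in> frontier D" and n: "F m \<bullet> v = 1"
  shows "m \<in> star D D' v"
proof (rule ccontr)
  assume no: "m \<notin> star D D' v"
  have mD: "m \<in> D" using m frontier_iff by blast
  define s where "s = Min ((\<lambda>w. 1 - m \<bullet> w) ` adjacent D' v)"
  have p: "push v m = m + s *\<^sub>R v" by (simp add: push_def s_def)
  obtain w where w: "w \<in> adjacent D' v" "push v m \<bullet> w = 1" using push_attained[OF v] by blast
  have "m \<bullet> w < 1" using no w(1) mD mem_iff by (force simp: star_def adjacent_def)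
  then have s: "s > 0" using w by (simp add: p adjacent_def inner_add_left)
  have "push v m \<bullet> u \<le> 1" if u: "u \<in> verts D'" for u
  proof (cases "u \<in> adjacent D' v")
    case True then show ?thesis by (rule push_le)
  next
    case False
    then have "s * (v \<bullet> u) \<le> 0" using nonadjacent_nonpos[OF v u] s by (simp add: mult_nonneg_nonpos)
    moreover have "m \<bullet> u \<le> 1" using mD mem_iff u by blast
    ultimately show ?thesis by (simp add: p inner_add_left)
  qed
  then have pf: "push v m \<in> frontier D" using w frontier_iff mem_iff by (auto simp: adjacent_def)
  note Fm = F_in[OF m]
  have "\<Phi> (push v m) + \<Psi> (F m) \<le> \<Phi> m + s + \<Psi> (F m)"
    using growth[of v s m] v verts_subset s p by auto
  \<comment> \<open>The pairing gains exactly \<open>s\<close> because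
    \<open>F m \<bullet> v = 1\<close>. This matches the growth bound, so duality at the pushed
    point is an equality.\<close>
  also have "\<dots> = push v m \<bullet> F m"
    using contact[OF m Fm] n by (simp add: p inner_add_left inner_commute[of v])
  finally have "F m = F (push v m)"
    using contact[OF pf Fm] duality[OF pf Fm] by linarith
  then have "push v m = m" using GF[OF m] GF[OF pf] by metis
  then show False using s vert_nonzero[OF v] by (simp add: p)
qed

lemma vertex_dom_openin: "v \<in> verts D \<Longrightarrow> openin (top_of_set (frontier D)) (vertex_dom v)"
proof -
  assume v: "v \<in> verts D"
  have "vertex_dom v = frontier D \<inter> F -` open_face D' D v" by (auto simp: vertex_dom_def)
  then show ?thesis
    using continuous_on_open_gen[of F "frontier D" "frontier D'"] homeo F_in
      polar_pair.open_face_openin[OF swap v] by (auto simp: homeomorphism_def image_subset_iff)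
qed

lemma vertex_dom_subset_star: "v \<in> verts D \<Longrightarrow> vertex_dom v \<subseteq> star D D' v"
  using contact_in_star by (auto simp: vertex_dom_def open_face_def)

lemma vertex_chart_at: "vertex_chart v n c \<Longrightarrow> chart_at v c"
  using vertex_dom_openin vertex_dom_subset_star
  by (auto simp: vertex_chart_def chart_at_def chart_dom_def chart_map_def)

lemma facet_chart_at: "facet_chart v w c \<Longrightarrow> chart_at v c"
  using open_face_openin open_face_subset_star
  by (auto simp: facet_chart_def chart_at_def chart_dom_def chart_map_def adjacent_def)

lemma atlas_cases:
  assumes "c \<in> atlas"
  obtains (vertex) v n where "vertex_chart v n c" | (facet) v w where "facet_chart v w c"
proof -
  note dual_facet = polar_pair.facet_iff[OF swap]
  have "(\<exists>\<tau> n. \<tau> facet_of D' \<and> n extreme_point_of \<tau> \<and>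
       c = (vertex_chart_dom D D' \<Phi> \<Psi> \<tau>, lattice_coords (b \<tau>), \<lambda>m. \<Phi> m - m \<bullet> n)) \<or>
     (\<exists>\<sigma> \<tau>. \<sigma> facet_of D \<and> \<tau> facet_of D' \<and> facet_vertex D \<tau> \<in> \<sigma> \<and>
       c = (rel_interior \<sigma>, lattice_coords (b \<tau>), \<Phi>))"
    using assms unfolding induced_atlas_def by blast
  then show ?thesis
  proof (elim disjE exE conjE)
    fix \<tau> n assume "\<tau> facet_of D'" and n: "n extreme_point_of \<tau>"
      and c: "c = (vertex_chart_dom D D' \<Phi> \<Psi> \<tau>, lattice_coords (b \<tau>), \<lambda>m. \<Phi> m - m \<bullet> n)"
    then obtain v where v: "v \<in> verts D" "\<tau> = face_at D' v" using dual_facet by blast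
    moreover have "n \<bullet> v = 1" using n v(2) by (auto simp: extreme_point_of_def face_at_def)
    ultimately show ?thesis
      using vertex[of v n] c vertex_chart_dom_eq by (simp add: vertex_chart_def coords_def)
  next
    fix \<sigma> \<tau> assume "\<sigma> facet_of D" "\<tau> facet_of D'" and f: "facet_vertex D \<tau> \<in> \<sigma>"
      and c: "c = (rel_interior \<sigma>, lattice_coords (b \<tau>), \<Phi>)"
    obtain v where v: "v \<in> verts D" "\<tau> = face_at D' v"
      using \<open>\<tau> facet_of D'\<close> dual_facet by blast
    obtain w where w: "w \<in> verts D'" "\<sigma> = face_at D w"
      using \<open>\<sigma> facet_of D\<close> facet_iff by blast
    have "w \<in> adjacent D' v"
      using f polar_pair.facet_vertex_face_at[OF swap v(1)] v w by (simp add: adjacent_def face_at_def)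
    then show ?thesis
      using facet[of v w] c v w rel_interior_face_at[OF w(1)] by (simp add: facet_chart_def coords_def)
  qed
qed

lemma atlas_chart_at: "c \<in> atlas \<Longrightarrow> \<exists>v. chart_at v c"
  by (elim atlas_cases) (blast intro: vertex_chart_at facet_chart_at)+

lemma chart_at_open_image:
  "chart_at v c \<Longrightarrow> U \<subseteq> chart_dom c \<Longrightarrow> openin (top_of_set (frontier D)) U \<Longrightarrow> open (chart_map c ` U)"
  unfolding chart_at_def coords_def
  using star_chart(1)[OF _ basis dim, of v U] by (auto simp: subset_trans)

lemma chart_at_homeomorphism:
  "chart_at v c \<Longrightarrow> homeomorphism (chart_dom c) (chart_map c ` chart_dom c) (chart_map c) (chart_inv c)"
  unfolding chart_at_def coords_def chart_inv_def
  using star_chart(3)[OF _ basis dim, of v "chart_dom c"] by auto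

lemma chart_at_inv: "chart_at v c \<Longrightarrow> m \<in> chart_dom c \<Longrightarrow> chart_inv c (chart_map c m) = m"
  using homeomorphism_apply1[OF chart_at_homeomorphism] .

lemma vertex_dom_unique: "m \<in> vertex_dom v \<Longrightarrow> v' \<in> verts D \<Longrightarrow> m \<in> vertex_dom v' \<Longrightarrow> v = v'"
proof -
  assume m: "m \<in> vertex_dom v" and v': "v' \<in> verts D" "m \<in> vertex_dom v'"
  have "F m \<bullet> v' = 1" using v'(2) by (simp add: vertex_dom_def open_face_def)
  moreover have "F m \<in> open_face D' D v" using m by (simp add: vertex_dom_def)
  ultimately show "v = v'" using polar_pair.open_face_unique[OF swap _ v'(1)] by blast
qed

text \<open>Some facet through \<open>m\<close> contains \<open>v\<close>, and a point of an open
  facet lies on no other facet.\<close>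

lemma vertex_dom_open_face:
  assumes "m \<in> vertex_dom v" "v \<in> verts D" "m \<in> open_face D D' w"
  shows "v \<bullet> w = 1"
proof -
  have "m \<in> star D D' v" using assms vertex_dom_subset_star by blast
  then obtain w' where "w' \<in> adjacent D' v" "m \<bullet> w' = 1" by (auto simp: star_def)
  then show ?thesis using open_face_unique[OF assms(3)] by (auto simp: adjacent_def)
qed

text \<open>Vertex charts at different vertices are disjoint. Any other overlapping pair involves a
  facet chart, so the overlap lies in the hyperplane of a facet through the vertex of the first
  chart.\<close>

lemma atlas_overlap:
  assumes "c \<in> atlas" "c' \<in> atlas" and ne: "chart_dom c \<inter> chart_dom c' \<noteq> {}"
  obtains (same) v n n' where "vertex_chart v n c" "vertex_chart v n' c'"
  | (facet) v v' w a where "chart_at v c" "chart_at v' c'" "v \<bullet> w = 1"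
     "\<And>m. m \<in> chart_dom c \<Longrightarrow> m \<in> chart_dom c' \<Longrightarrow> m \<bullet> w = 1"
     "\<And>m. chart_pot c m - chart_pot c' m = m \<bullet> a"
proof -
  obtain m where m: "m \<in> chart_dom c" "m \<in> chart_dom c'" using ne by blast
  note simps = vertex_chart_def facet_chart_def chart_dom_def chart_pot_def
  from assms(1) show ?thesis
  proof (cases rule: atlas_cases)
    case c: (vertex v n)
    from assms(2) show ?thesis
    proof (cases rule: atlas_cases)
      case c': (vertex v' n')
      have "v = v'" using vertex_dom_unique[of m v v'] c c' m by (auto simp: simps)
      then show ?thesis using same c c' by blast
    next
      case c': (facet v' w)
      have "v \<bullet> w = 1" using vertex_dom_open_face[of m v w] c c' m by (auto simp: simps)
      then show ?thesis
        using facet[of v v' w "- n", OF vertex_chart_at[OF c] facet_chart_at[OF c']] c c'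
        by (auto simp: simps open_face_def)
    qed
  next
    case c: (facet v w)
    have vw: "v \<bullet> w = 1" using c by (auto simp: simps adjacent_def)
    from assms(2) show ?thesis
    proof (cases rule: atlas_cases)
      case c': (vertex v' n')
      show ?thesis
        using facet[of v v' w n', OF facet_chart_at[OF c] vertex_chart_at[OF c'] vw] c c'
        by (auto simp: simps open_face_def)
    next
      case c': (facet v' w')
      show ?thesis
        using facet[of v v' w 0, OF facet_chart_at[OF c] facet_chart_at[OF c'] vw] c c'
        by (auto simp: simps open_face_def)
    qed
  qed
qed

section \<open>Affine transition maps and potential differences\<close>

lemma locally_affine_onI:
  fixes f :: "'v::real_normed_vector \<Rightarrow> 'w::real_vector"
  assumes "linear L" "\<And>x. x \<in> S \<Longrightarrow> f x = L x + k"
  shows "locally_affine_on S f"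
  unfolding locally_affine_on_def using assms by (metis IntD1 UNIV_I open_UNIV)

lemma chart_at_affine:
  assumes "chart_at v c" "v \<bullet> w = 1"
  obtains K where "linear K" "\<And>m. m \<bullet> w = 1 \<Longrightarrow> m = K (chart_map c m) + v"
  using affine_on_facet[OF basis vert_nonzero dim assms(2)] assms(1)
  unfolding chart_at_def coords_def by metis

lemma transition_affine:
  assumes "c \<in> atlas" "c' \<in> atlas"
  shows "locally_affine_on (chart_map c ` (chart_dom c \<inter> chart_dom c')) (chart_map c' \<circ> chart_inv c)"
proof (cases "chart_dom c \<inter> chart_dom c' = {}")
  case True
  then show ?thesis by (simp add: locally_affine_on_def)
next
  case False
  from assms False show ?thesis
  proof (cases rule: atlas_overlap)
    case (same v n n')
    have "chart_map c' = chart_map c"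
      using same by (simp add: vertex_chart_def chart_map_def)
    then have "(chart_map c' \<circ> chart_inv c) x = x + 0" if "x \<in> chart_map c ` (chart_dom c \<inter> chart_dom c')" for x
      using that chart_at_inv[OF vertex_chart_at[OF same(1)]] by auto
    moreover have "linear (\<lambda>x::real^'d. x)" by (rule linearI) auto
    ultimately show ?thesis by (intro locally_affine_onI)
  next
    case (facet v v' w a)
    obtain K where K: "linear K" "\<And>m. m \<bullet> w = 1 \<Longrightarrow> m = K (chart_map c m) + v"
      using chart_at_affine[OF facet(1,3)] by blast
    have l: "linear (chart_map c')"
      using facet(2) linear_lattice_coords by (simp add: chart_at_def coords_def)
    show ?thesis
    proof (rule locally_affine_onI)
      show "linear (chart_map c' \<circ> K)" using linear_compose[OF K(1) l] .
      fix x assume "x \<in> chart_map c ` (chart_dom c \<inter> chart_dom c')"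
      then obtain m where m: "m \<in> chart_dom c" "m \<in> chart_dom c'" "x = chart_map c m" by blast
      have "chart_map c' m = chart_map c' (K x + v)" using K(2) facet(4)[OF m(1,2)] m(3) by simp
      then show "(chart_map c' \<circ> chart_inv c) x = (chart_map c' \<circ> K) x + chart_map c' v"
        using chart_at_inv[OF facet(1) m(1)] by (simp add: m(3) linear_add[OF l])
    qed
  qed
qed

lemma potential_difference_affine:
  assumes "c \<in> atlas" "c' \<in> atlas"
  shows "locally_affine_on (chart_map c ` (chart_dom c \<inter> chart_dom c'))
    (\<lambda>x. chart_pot c (chart_inv c x) - chart_pot c' (chart_inv c x))"
proof (cases "chart_dom c \<inter> chart_dom c' = {}")
  case True
  then show ?thesis by (simp add: locally_affine_on_def)
next
  case False
  from assms False show ?thesis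
  proof (cases rule: atlas_overlap)
    case (same v n n')
    have v: "v \<in> verts D" "chart_map c = lattice_coords (b (face_at D' v))" "v \<bullet> (n' - n) = 0"
      using same by (auto simp: vertex_chart_def chart_map_def coords_def inner_diff_right inner_commute)
    \<comment> \<open>A vector orthogonal to \<open>v\<close> pairs with points through their
      coordinates alone.\<close>
    obtain \<xi> :: "real^'d" where \<xi>: "n' - n = (\<Sum>i\<in>UNIV. \<xi> $ i *\<^sub>R b (face_at D' v) i)"
      using basis[OF v(1)] v(3) unfolding perp_basis_def by blast
    show ?thesis
    proof (rule locally_affine_onI)
      show "linear (\<lambda>x::real^'d. x \<bullet> \<xi>)" by (rule linearI) (auto simp: inner_add_left)
      fix x assume "x \<in> chart_map c ` (chart_dom c \<inter> chart_dom c')"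
      then obtain m where m: "m \<in> chart_dom c" "x = chart_map c m" by blast
      have "chart_pot c m - chart_pot c' m = m \<bullet> (n' - n)"
        using same by (simp add: vertex_chart_def chart_pot_def inner_diff_right)
      also have "\<dots> = x \<bullet> \<xi>" unfolding \<xi> inner_lincomb_lattice_coords m(2) v(2) ..
      finally show "chart_pot c (chart_inv c x) - chart_pot c' (chart_inv c x) = x \<bullet> \<xi> + 0"
        using chart_at_inv[OF vertex_chart_at[OF same(1)] m(1)] by (simp add: m(2))
    qed
  next
    case (facet v v' w a)
    obtain K where K: "linear K" "\<And>m. m \<bullet> w = 1 \<Longrightarrow> m = K (chart_map c m) + v"
      using chart_at_affine[OF facet(1,3)] by blast
    show ?thesis
    proof (rule locally_affine_onI)
      show "linear (\<lambda>x. K x \<bullet> a)"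
        by (rule linearI) (auto simp: inner_add_left linear_add[OF K(1)] linear_cmul[OF K(1)])
      fix x assume "x \<in> chart_map c ` (chart_dom c \<inter> chart_dom c')"
      then obtain m where m: "m \<in> chart_dom c" "m \<in> chart_dom c'" "x = chart_map c m" by blast
      have "m \<bullet> a = (K x + v) \<bullet> a" using K(2) facet(4)[OF m(1,2)] m(3) by simp
      then show "chart_pot c (chart_inv c x) - chart_pot c' (chart_inv c x) = K x \<bullet> a + v \<bullet> a"
        using chart_at_inv[OF facet(1) m(1)] facet(5)[of m] by (simp add: m(3) inner_add_left)
    qed
  qed
qed

section \<open>The Hessian manifold\<close>

abbreviation domain :: "'a set" where
  "domain \<equiv> induced_domain D D' \<Phi> \<Psi>"

lemma domain_eq: "domain = (\<Union>w\<in>verts D'. open_face D D' w) \<union> (\<Union>v\<in>verts D. vertex_dom v)"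
proof -
  have "(\<Union>\<sigma> \<in> {\<sigma>. \<sigma> facet_of D}. rel_interior \<sigma>) = (\<Union>w\<in>verts D'. open_face D D' w)"
    using facet_iff rel_interior_face_at by auto
  moreover have "(\<Union>\<tau> \<in> {\<tau>. \<tau> facet_of D'}. vertex_chart_dom D D' \<Phi> \<Psi> \<tau>) = (\<Union>v\<in>verts D. vertex_dom v)"
    using polar_pair.facet_iff[OF swap] vertex_chart_dom_eq by auto
  ultimately show ?thesis by (simp add: induced_domain_def)
qed

lemma domain_subset_frontier: "domain \<subseteq> frontier D"
  unfolding domain_eq using open_face_subset_frontier by (auto simp: vertex_dom_def)

lemma atlas_covers: "(\<Union>c\<in>atlas. chart_dom c) = domain"
proof
  show "(\<Union>c\<in>atlas. chart_dom c) \<subseteq> domain"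
  proof
    fix m assume "m \<in> (\<Union>c\<in>atlas. chart_dom c)"
    then obtain c where c: "c \<in> atlas" "m \<in> chart_dom c" by blast
    from c(1) show "m \<in> domain"
      by (cases rule: atlas_cases)
         (use c(2) in \<open>auto simp: domain_eq vertex_chart_def facet_chart_def chart_dom_def adjacent_def\<close>)
  qed
  show "domain \<subseteq> (\<Union>c\<in>atlas. chart_dom c)"
  proof
    fix m assume "m \<in> domain"
    then consider \<sigma> where "\<sigma> facet_of D" "m \<in> rel_interior \<sigma>"
      | \<tau> where "\<tau> facet_of D'" "m \<in> vertex_chart_dom D D' \<Phi> \<Psi> \<tau>"
      unfolding induced_domain_def by blast
    then show "m \<in> (\<Union>c\<in>atlas. chart_dom c)"
    proof cases
      case 1
      obtain w where w: "w \<in> verts D'" "\<sigma> = face_at D w" using facet_iff 1(1) by blast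
      \<comment> \<open>A facet chart needs a vertex of its facet to supply coordinates.\<close>
      obtain v where v: "v \<in> verts D" "v \<bullet> w = 1"
        using polar_pair.adjacent_exists[OF swap w(1)] by (auto simp: adjacent_def inner_commute)
      have "face_at D' v facet_of D'" using polar_pair.facet_iff[OF swap] v by blast
      moreover have "facet_vertex D (face_at D' v) \<in> \<sigma>"
        using polar_pair.facet_vertex_face_at[OF swap v(1)] v w verts_subset by (auto simp: face_at_def)
      ultimately have "(rel_interior \<sigma>, lattice_coords (b (face_at D' v)), \<Phi>) \<in> atlas"
        unfolding induced_atlas_def using 1(1) by blast
      then show ?thesis using 1(2) by (force simp: chart_dom_def)
    next
      case 2
      \<comment> \<open>A vertex of \<tau> has to exist, since it selects a potential on
        U_\<tau>.\<close>
      have "compact \<tau>" "convex \<tau>" "\<tau> \<noteq> {}"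
        using 2(1) polytope_imp_compact face_of_polytope_polytope[OF polytope(2)] face_of_imp_convex
        by (auto simp: facet_of_def)
      then obtain n where "n extreme_point_of \<tau>" using extreme_point_exists_convex by blast
      then have "(vertex_chart_dom D D' \<Phi> \<Psi> \<tau>, lattice_coords (b \<tau>), \<lambda>m. \<Phi> m - m \<bullet> n) \<in> atlas"
        unfolding induced_atlas_def using 2(1) by blast
      then show ?thesis using 2(2) by (force simp: chart_dom_def)
    qed
  qed
qed

lemma hessian_manifold_atlas: "hessian_manifold domain atlas"
proof -
  have "openin (top_of_set domain) (chart_dom c) \<and> open (chart_map c ` chart_dom c) \<and>
      homeomorphism (chart_dom c) (chart_map c ` chart_dom c) (chart_map c) (chart_inv c)" if c: "c \<in> atlas" for c
  proof -
    obtain v where v: "chart_at v c" using atlas_chart_at[OF c] by blast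
    then have o: "openin (top_of_set (frontier D)) (chart_dom c)" by (simp add: chart_at_def)
    have "chart_dom c \<subseteq> domain" using atlas_covers c by blast
    then show ?thesis
      using openin_subset_trans[OF o _ domain_subset_frontier] chart_at_open_image[OF v order_refl o]
        chart_at_homeomorphism[OF v] by blast
  qed
  then show ?thesis
    unfolding hessian_manifold_def affine_atlas_def compatible_potentials_def
    using atlas_covers transition_affine potential_difference_affine smooth by blast
qed

section \<open>The map \<open>F\<close> as a gradient\<close>

lemma atlas_smooth:
  assumes "c \<in> atlas"
  shows "smooth_on (chart_map c ` chart_dom c) (chart_pot c \<circ> chart_inv c)"
    and "x \<in> chart_map c ` chart_dom c \<Longrightarrow> pos_def (hessian (chart_pot c \<circ> chart_inv c) x)"
  using smooth assms by (auto simp: smooth_potentials_def hess_metric_def)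

text \<open>By \<open>duality\<close> and \<open>contact\<close>, \<Phi> minus the pairing with
  \<open>F m\<close> is minimal at \<open>m\<close>. The assumption \<open>lin\<close> rewrites this
  function as the potential minus a linear function of the coordinates, up to a constant, and its
  derivative vanishes at the interior minimum.\<close>

lemma potential_gradient:
  assumes c: "c \<in> atlas" "chart_at v c" and m: "m \<in> chart_dom c"
    and pot: "\<And>m'. chart_pot c m' = \<Phi> m' - m' \<bullet> n"
    and lin: "\<And>m'. m' \<in> chart_dom c \<Longrightarrow> m' \<bullet> (F m - n) = chart_map c m' \<bullet> \<xi> + k"
  shows "pderiv_at i (chart_pot c \<circ> chart_inv c) (chart_map c m) = \<xi> $ i"
proof -
  let ?\<phi> = "chart_pot c \<circ> chart_inv c" and ?S = "chart_map c ` chart_dom c" and ?x = "chart_map c m"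
  have op: "openin (top_of_set (frontier D)) (chart_dom c)" using c(2) by (simp add: chart_at_def)
  then have fr: "chart_dom c \<subseteq> frontier D" by (auto dest: openin_imp_subset)
  have mf: "m \<in> frontier D" using m fr by blast
  have S: "open ?S" by (rule chart_at_open_image[OF c(2) order_refl op])
  have d: "(?\<phi> has_derivative frechet_derivative ?\<phi> (at ?x)) (at ?x)"
    using differentiable_has_frechet[OF smooth_on_differentiable[OF atlas_smooth(1)[OF c(1)]]] m by blast
  have min: "?\<phi> ?x - ?x \<bullet> \<xi> \<le> ?\<phi> y - y \<bullet> \<xi>" if y: "y \<in> ?S" for y
  proof -
    obtain m' where m': "m' \<in> chart_dom c" "y = chart_map c m'" using y by blast
    have val: "?\<phi> (chart_map c m'') - chart_map c m'' \<bullet> \<xi> = \<Phi> m'' - m'' \<bullet> F m + k" if "m'' \<in> chart_dom c" for m''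
      using lin[OF that] chart_at_inv[OF c(2) that] by (simp add: pot inner_diff_right)
    have "\<Phi> m - m \<bullet> F m = - \<Psi> (F m)" using contact[OF mf F_in[OF mf]] by simp
    also have "\<dots> \<le> \<Phi> m' - m' \<bullet> F m" using duality[OF _ F_in[OF mf], of m'] m'(1) fr by auto
    finally show ?thesis using val[OF m] val[OF m'(1)] m'(2) by simp
  qed
  have "((\<lambda>y. ?\<phi> y - y \<bullet> \<xi>) has_derivative (\<lambda>v. frechet_derivative ?\<phi> (at ?x) v - v \<bullet> \<xi>)) (at ?x)"
    by (rule has_derivative_diff[OF d]) (auto intro!: derivative_eq_intros)
  then have "(\<lambda>v. frechet_derivative ?\<phi> (at ?x) v - v \<bullet> \<xi>) = (\<lambda>v. 0)"
    using differential_zero_maxmin[of ?x ?S "\<lambda>y. ?\<phi> y - y \<bullet> \<xi>"] S m min by blast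
  then have "frechet_derivative ?\<phi> (at ?x) (axis i 1) - axis i 1 \<bullet> \<xi> = 0" by (rule fun_cong)
  then show ?thesis by (simp add: pderiv_at_def inner_axis')
qed

lemma vertex_chart_gradient:
  assumes c: "c \<in> atlas" "vertex_chart v n c" and m: "m \<in> chart_dom c"
  shows "F m = n + (\<Sum>i\<in>UNIV. pderiv_at i (chart_pot c \<circ> chart_inv c) (chart_map c m) *\<^sub>R b (face_at D' v) i)"
proof -
  have v: "v \<in> verts D" "chart_map c = lattice_coords (b (face_at D' v))" "v \<bullet> (F m - n) = 0"
    using c(2) m by (auto simp: vertex_chart_def vertex_dom_def chart_dom_def chart_map_def coords_def
        open_face_def inner_diff_right inner_commute)
  obtain \<xi> :: "real^'d" where \<xi>: "F m - n = (\<Sum>i\<in>UNIV. \<xi> $ i *\<^sub>R b (face_at D' v) i)"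
    using basis[OF v(1)] v(3) unfolding perp_basis_def by blast
  have "pderiv_at i (chart_pot c \<circ> chart_inv c) (chart_map c m) = \<xi> $ i" for i
  proof (rule potential_gradient[OF c(1) vertex_chart_at[OF c(2)] m])
    show "m' \<bullet> (F m - n) = chart_map c m' \<bullet> \<xi> + 0" for m'
      unfolding \<xi> inner_lincomb_lattice_coords v(2) by simp
  qed (use c(2) in \<open>simp add: vertex_chart_def chart_pot_def\<close>)
  then show ?thesis using \<xi> by (simp add: algebra_simps)
qed

text \<open>Subtracting \<open>(F m \<bullet> v) *\<^sub>R w\<close> makes the rest orthogonal to
  \<open>v\<close>, since \<open>v \<bullet> w = 1\<close>. On the facet, pairing with
  \<open>w\<close> is constantly 1, so the subtracted term only adds a constant and escapes the
  gradient.\<close>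

lemma facet_chart_gradient:
  assumes c: "c \<in> atlas" "facet_chart v w c" and m: "m \<in> chart_dom c"
  shows "F m = (F m \<bullet> v) *\<^sub>R w +
    (\<Sum>i\<in>UNIV. pderiv_at i (chart_pot c \<circ> chart_inv c) (chart_map c m) *\<^sub>R b (face_at D' v) i)"
proof -
  have v: "v \<in> verts D" "chart_map c = lattice_coords (b (face_at D' v))" "v \<bullet> (F m - (F m \<bullet> v) *\<^sub>R w) = 0"
    using c(2) by (auto simp: facet_chart_def chart_map_def coords_def
        adjacent_def inner_diff_right inner_commute)
  obtain \<xi> :: "real^'d" where \<xi>: "F m - (F m \<bullet> v) *\<^sub>R w = (\<Sum>i\<in>UNIV. \<xi> $ i *\<^sub>R b (face_at D' v) i)"
    using basis[OF v(1)] v(3) unfolding perp_basis_def by blast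
  have "pderiv_at i (chart_pot c \<circ> chart_inv c) (chart_map c m) = \<xi> $ i" for i
  proof (rule potential_gradient[OF c(1) facet_chart_at[OF c(2)] m])
    show "m' \<bullet> (F m - 0) = chart_map c m' \<bullet> \<xi> + (F m \<bullet> v)" if "m' \<in> chart_dom c" for m'
    proof -
      have "m' \<bullet> w = 1" using that c(2) by (auto simp: facet_chart_def chart_dom_def open_face_def)
      moreover have "m' \<bullet> (F m - (F m \<bullet> v) *\<^sub>R w) = chart_map c m' \<bullet> \<xi>"
        unfolding \<xi> inner_lincomb_lattice_coords v(2) ..
      ultimately show ?thesis by (simp add: inner_diff_right)
    qed
  qed (use c(2) in \<open>simp add: facet_chart_def chart_pot_def\<close>)
  then show ?thesis using \<xi> by (simp add: algebra_simps)
qed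

text \<open>The set \<open>R\<close> is a parameter because the representation may hold only on the
  part of a chart that \<open>F\<close> maps into one target chart.\<close>

definition gradient_rep :: "('a, 'd) hchart \<Rightarrow> ('d \<Rightarrow> 'a) \<Rightarrow> 'a set \<Rightarrow> ('d \<Rightarrow> 'd \<Rightarrow> real) \<Rightarrow> bool" where
  "gradient_rep c \<beta>' R P \<longleftrightarrow> (\<exists>k. \<forall>m\<in>R. \<forall>j. F m \<bullet> \<beta>' j =
     k j + (\<Sum>i\<in>UNIV. P j i * pderiv_at i (chart_pot c \<circ> chart_inv c) (chart_map c m)))"

lemma vertex_gradient_rep:
  assumes c: "c \<in> atlas" "vertex_chart v n c" and R: "R \<subseteq> chart_dom c"
  shows "gradient_rep c \<beta>' R (coupling (b (face_at D' v)) \<beta>' 0 0)"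
  unfolding gradient_rep_def
proof (intro exI ballI allI)
  fix m j assume "m \<in> R"
  then have m: "m \<in> chart_dom c" using R by blast
  show "F m \<bullet> \<beta>' j = n \<bullet> \<beta>' j + (\<Sum>i\<in>UNIV. coupling (b (face_at D' v)) \<beta>' 0 0 j i *
      pderiv_at i (chart_pot c \<circ> chart_inv c) (chart_map c m))"
    by (subst vertex_chart_gradient[OF c m])
       (simp add: coupling_def inner_add_left inner_sum_left mult.commute inner_commute[of "\<beta>' j"])
qed

text \<open>The unknown multiple of \<open>w\<close> is orthogonal to the target coordinates and
  disappears.\<close>

lemma facet_gradient_rep_perp:
  assumes c: "c \<in> atlas" "facet_chart v w c" and R: "R \<subseteq> chart_dom c" and "\<And>j. w \<bullet> \<beta>' j = 0"
  shows "gradient_rep c \<beta>' R (coupling (b (face_at D' v)) \<beta>' 0 0)"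
  unfolding gradient_rep_def
proof (intro exI ballI allI)
  fix m j assume "m \<in> R"
  then have m: "m \<in> chart_dom c" using R by blast
  show "F m \<bullet> \<beta>' j = 0 + (\<Sum>i\<in>UNIV. coupling (b (face_at D' v)) \<beta>' 0 0 j i *
      pderiv_at i (chart_pot c \<circ> chart_inv c) (chart_map c m))"
    by (subst facet_chart_gradient[OF c m])
       (simp add: coupling_def inner_add_left inner_sum_left mult.commute inner_commute[of "\<beta>' j"] assms(4))
qed

text \<open>The condition \<open>F m \<bullet> u = 1\<close> eliminates the unknown \<open>F m \<bullet> v\<close> from \<open>facet_chart_gradient\<close>.\<close>

lemma facet_gradient_rep:
  assumes c: "c \<in> atlas" "facet_chart v w c" and R: "R \<subseteq> chart_dom c"
    and u: "u \<bullet> w = 1" "\<And>m. m \<in> R \<Longrightarrow> F m \<bullet> u = 1"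
  shows "gradient_rep c \<beta>' R (coupling (b (face_at D' v)) \<beta>' u w)"
  unfolding gradient_rep_def
proof (intro exI ballI allI)
  fix m j assume mR: "m \<in> R"
  then have m: "m \<in> chart_dom c" using R by blast
  define p where "p i = pderiv_at i (chart_pot c \<circ> chart_inv c) (chart_map c m)" for i
  define \<beta> where "\<beta> = b (face_at D' v)"
  define a where "a = F m \<bullet> v"
  have Fm: "F m = a *\<^sub>R w + (\<Sum>i\<in>UNIV. p i *\<^sub>R \<beta> i)"
    unfolding p_def \<beta>_def a_def by (rule facet_chart_gradient[OF c m])
  have "1 = u \<bullet> F m" using u(2)[OF mR] by (simp add: inner_commute)
  also have "\<dots> = a + (\<Sum>i\<in>UNIV. p i * (u \<bullet> \<beta> i))"
    unfolding Fm by (simp add: inner_add_right inner_sum_right u(1))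
  \<comment> \<open>Substituting this value of \<open>a\<close> produces the product term in
    \<open>coupling\<close>.\<close>
  finally have a: "a = 1 - (\<Sum>i\<in>UNIV. p i * (u \<bullet> \<beta> i))" by simp
  have "F m \<bullet> \<beta>' j = a * (\<beta>' j \<bullet> w) + (\<Sum>i\<in>UNIV. p i * (\<beta>' j \<bullet> \<beta> i))"
    by (subst inner_commute, unfold Fm) (simp add: inner_add_right inner_sum_right)
  also have "\<dots> = w \<bullet> \<beta>' j + (\<Sum>i\<in>UNIV. coupling \<beta> \<beta>' u w j i * p i)"
    unfolding a
    by (simp add: coupling_def left_diff_distrib right_diff_distrib sum_subtractf sum_distrib_left inner_commute[of w] mult_ac)
  finally show "F m \<bullet> \<beta>' j = w \<bullet> \<beta>' j + (\<Sum>i\<in>UNIV. coupling (b (face_at D' v)) \<beta>' u w j i *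
      pderiv_at i (chart_pot c \<circ> chart_inv c) (chart_map c m))"
    by (simp add: p_def \<beta>_def)
qed

section \<open>Pairs of charts on the two sides\<close>

lemma gradient_rep_empty: "gradient_rep c \<beta>' {} P"
  by (simp add: gradient_rep_def)

text \<open>In the mixed cases the vertex chart and the open facet carry the same label, so the
  unknown term is orthogonal to the target coordinates. For two facet charts, membership in the
  opposite open facet supplies the missing equation on each side.\<close>

lemma atlas_pair_gradient_rep:
  assumes c: "c \<in> atlas" and c': "c' \<in> induced_atlas D' D \<Psi> \<Phi> b'"
  defines "R \<equiv> chart_dom c \<inter> F -` chart_dom c'"
  obtains (pair) v w P where "chart_at v c" "mirror.chart_at D' D b' w c'"
    "gradient_rep c (b' (face_at D w)) R P"
    "mirror.gradient_rep G c' (b (face_at D' v)) (F ` R) (\<lambda>i j. P j i)"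
proof -
  interpret dual: mirror D' D \<Psi> \<Phi> G F b' b by (rule mirror_swap)
  have fr: "m \<in> frontier D" if "m \<in> chart_dom c" for m
    using atlas_chart_at[OF c] that by (auto simp: chart_at_def dest: openin_imp_subset)
  have R: "R \<subseteq> chart_dom c" "F ` R \<subseteq> chart_dom c'" by (auto simp: R_def)
  have perp: "v \<bullet> b (face_at D' v) i = 0" if "v \<in> verts D" for v i
    using basis[OF that] by (simp add: perp_basis_def)
  have perp': "w \<bullet> b' (face_at D w) i = 0" if "w \<in> verts D'" for w i
    using basis'[OF that] by (simp add: perp_basis_def)
  have finish: thesis if "chart_at v c" "dual.chart_at w c'"
    "gradient_rep c (b' (face_at D w)) R (coupling (b (face_at D' v)) (b' (face_at D w)) u z)"
    "dual.gradient_rep c' (b (face_at D' v)) (F ` R) (coupling (b' (face_at D w)) (b (face_at D' v)) z u)" for v w u z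
    by (rule pair[OF that(1-3)]) (simp only: coupling_transpose that(4))
  note simps = vertex_chart_def facet_chart_def dual.vertex_chart_def dual.facet_chart_def chart_dom_def
    vertex_dom_def dual.vertex_dom_def
  show ?thesis
  \<comment> \<open>A point of \<open>R\<close> is what relates the labels of the two charts;
    without one the representations hold vacuously.\<close>
  proof (cases "R = {}")
    case True
    obtain v w where "chart_at v c" "dual.chart_at w c'"
      using atlas_chart_at[OF c] dual.atlas_chart_at[OF c'] by blast
    then show ?thesis
      by (rule finish) (simp_all add: True gradient_rep_empty dual.gradient_rep_empty)
  next
    case False
    then obtain m where m: "m \<in> chart_dom c" "F m \<in> chart_dom c'" by (auto simp: R_def)
    have GFm: "G (F m) = m" using GF fr m by blast
    from c show ?thesis
    proof (cases rule: atlas_cases)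
      case v: (vertex v n)
      from c' show ?thesis
      proof (cases rule: dual.atlas_cases)
        case w: (vertex w n')
        show ?thesis
          by (rule finish[OF vertex_chart_at[OF v] dual.vertex_chart_at[OF w]
                vertex_gradient_rep[OF c v R(1)] dual.vertex_gradient_rep[OF c' w R(2)]])
      next
        case w: (facet w v')
        have mm: "F m \<in> open_face D' D v" "F m \<bullet> v' = 1" "v' \<in> verts D" "v \<in> verts D"
          using m v w by (auto simp: simps adjacent_def open_face_def)
        then have v': "v' = v" using dual.open_face_unique[of "F m" v v'] by blast
        have "v' \<bullet> b (face_at D' v) j = 0" for j using perp[OF mm(4)] v' by simp
        then show ?thesis
          by (rule finish[OF vertex_chart_at[OF v] dual.facet_chart_at[OF w]
                vertex_gradient_rep[OF c v R(1)] dual.facet_gradient_rep_perp[OF c' w R(2)]])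
      qed
    next
      case v: (facet v w)
      from c' show ?thesis
      proof (cases rule: dual.atlas_cases)
        case w: (vertex w' n')
        have mm: "m \<in> open_face D D' w'" "m \<bullet> w = 1" "w' \<in> verts D'" "w \<in> verts D'"
          using m v w GFm by (auto simp: simps adjacent_def open_face_def)
        then have w': "w = w'" using open_face_unique[of m w' w] by blast
        have "w \<bullet> b' (face_at D w') j = 0" for j using perp'[OF mm(3)] w' by simp
        then show ?thesis
          by (rule finish[OF facet_chart_at[OF v] dual.vertex_chart_at[OF w]
                facet_gradient_rep_perp[OF c v R(1)] dual.vertex_gradient_rep[OF c' w R(2)]])
      next
        case w: (facet w' v')
        have mm: "m \<in> open_face D D' w" "F m \<in> open_face D' D v'" "v' \<in> verts D"
          using m v w by (auto simp: simps adjacent_def)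
        \<comment> \<open>The point \<open>m\<close> lies in the domain U_\<tau> belonging to
          \<open>v'\<close> and in the open facet of \<open>w\<close>, so that facet contains
          \<open>v'\<close>.\<close>
        then have vw: "v' \<bullet> w = 1" "w \<bullet> v' = 1"
          using vertex_dom_open_face[of m v' w] fr[OF m(1)] by (auto simp: vertex_dom_def inner_commute)
        have 1: "F m' \<bullet> v' = 1" if "m' \<in> R" for m'
          using that w by (auto simp: R_def simps open_face_def)
        have 2: "G n \<bullet> w = 1" if n: "n \<in> F ` R" for n
        proof -
          obtain m' where m': "m' \<in> chart_dom c" "n = F m'" using n by (auto simp: R_def)
          then have "G n = m'" using GF fr by blast
          then show ?thesis using m'(1) v by (auto simp: simps open_face_def)
        qed
        show ?thesis
          by (rule finish[OF facet_chart_at[OF v] dual.facet_chart_at[OF w]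
                facet_gradient_rep[OF c v R(1) vw(1) 1] dual.facet_gradient_rep[OF c' w R(2) vw(2) 2]])
      qed
    qed
  qed
qed

lemma local_dom_open:
  assumes "c \<in> atlas" "c' \<in> induced_atlas D' D \<Psi> \<Phi> b'"
  shows "open (local_dom c c' F)"
proof -
  interpret dual: mirror D' D \<Psi> \<Phi> G F b' b by (rule mirror_swap)
  obtain v w where v: "chart_at v c" and w: "dual.chart_at w c'"
    using atlas_chart_at[OF assms(1)] dual.atlas_chart_at[OF assms(2)] by blast
  have o: "openin (top_of_set (frontier D)) (frontier D \<inter> F -` chart_dom c')"
    using continuous_on_open_gen[of F "frontier D" "frontier D'"] homeo F_in w
    by (auto simp: homeomorphism_def image_subset_iff dual.chart_at_def)
  have oc: "openin (top_of_set (frontier D)) (chart_dom c)" using v by (simp add: chart_at_def)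
  then have "chart_dom c \<inter> F -` chart_dom c' = chart_dom c \<inter> (frontier D \<inter> F -` chart_dom c')"
    by (auto dest: openin_imp_subset)
  then have "openin (top_of_set (frontier D)) (chart_dom c \<inter> F -` chart_dom c')"
    using openin_Int[OF oc o] by simp
  then show ?thesis unfolding local_dom_def using chart_at_open_image[OF v] by blast
qed

lemma local_rep_gradient_map:
  assumes c: "c \<in> atlas" and v: "chart_at v c" and "chart_map c' = lattice_coords \<beta>'"
    and rep: "gradient_rep c \<beta>' (chart_dom c \<inter> F -` chart_dom c') P"
  obtains k where "\<And>x. x \<in> local_dom c c' F \<Longrightarrow> local_rep c c' F x =
    (\<chi> j. k j + (\<Sum>i\<in>UNIV. P j i * pderiv_at i (chart_pot c \<circ> chart_inv c) x))"
proof -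
  obtain k where k: "\<And>m j. m \<in> chart_dom c \<inter> F -` chart_dom c' \<Longrightarrow> F m \<bullet> \<beta>' j =
     k j + (\<Sum>i\<in>UNIV. P j i * pderiv_at i (chart_pot c \<circ> chart_inv c) (chart_map c m))"
    using rep unfolding gradient_rep_def by blast
  show ?thesis
  proof (rule that[of k])
    fix x assume "x \<in> local_dom c c' F"
    then obtain m where m: "m \<in> chart_dom c \<inter> F -` chart_dom c'" "x = chart_map c m"
      by (auto simp: local_dom_def)
    then have "local_rep c c' F x = lattice_coords \<beta>' (F m)"
      using chart_at_inv[OF v] by (simp add: local_rep_def assms(3))
    also have "\<dots> = (\<chi> j. k j + (\<Sum>i\<in>UNIV. P j i * pderiv_at i (chart_pot c \<circ> chart_inv c) x))"
      unfolding lattice_coords_def vec_eq_iff m(2) using k[OF m(1)] by simp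
    finally show "local_rep c c' F x = (\<chi> j. k j + (\<Sum>i\<in>UNIV. P j i * pderiv_at i (chart_pot c \<circ> chart_inv c) x))" .
  qed
qed

text \<open>Puts both directions into the form required by the gradient map lemmas, with one matrix
  for both.\<close>

lemma local_rep_pair:
  assumes c: "c \<in> atlas" and c': "c' \<in> induced_atlas D' D \<Psi> \<Phi> b'"
  obtains (pair) k k' P where
    "\<And>x. x \<in> local_dom c c' F \<Longrightarrow> local_rep c c' F x =
      (\<chi> j. k j + (\<Sum>i\<in>UNIV. P j i * pderiv_at i (chart_pot c \<circ> chart_inv c) x))"
    "\<And>y. y \<in> local_dom c' c G \<Longrightarrow> local_rep c' c G y =
      (\<chi> i. k' i + (\<Sum>j\<in>UNIV. P j i * pderiv_at j (chart_pot c' \<circ> chart_inv c') y))"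
    "\<And>x. x \<in> local_dom c c' F \<Longrightarrow>
      local_rep c c' F x \<in> local_dom c' c G \<and> local_rep c' c G (local_rep c c' F x) = x"
proof -
  interpret dual: mirror D' D \<Psi> \<Phi> G F b' b by (rule mirror_swap)
  obtain v w P where v: "chart_at v c" and w: "dual.chart_at w c'"
    and rep: "gradient_rep c (b' (face_at D w)) (chart_dom c \<inter> F -` chart_dom c') P"
    and rep': "dual.gradient_rep c' (b (face_at D' v)) (F ` (chart_dom c \<inter> F -` chart_dom c')) (\<lambda>i j. P j i)"
    using atlas_pair_gradient_rep[OF c c'] by blast
  have dc: "chart_dom c \<subseteq> frontier D" "chart_dom c' \<subseteq> frontier D'"
    using v w by (auto simp: chart_at_def dual.chart_at_def dest: openin_imp_subset)
  have img: "F ` (chart_dom c \<inter> F -` chart_dom c') = chart_dom c' \<inter> G -` chart_dom c"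
    using dc GF FG by force
  have maps: "chart_map c = lattice_coords (b (face_at D' v))" "chart_map c' = lattice_coords (b' (face_at D w))"
    using v w by (auto simp: chart_at_def dual.chart_at_def coords_def dual.coords_def)
  obtain k where k: "\<And>x. x \<in> local_dom c c' F \<Longrightarrow> local_rep c c' F x =
      (\<chi> j. k j + (\<Sum>i\<in>UNIV. P j i * pderiv_at i (chart_pot c \<circ> chart_inv c) x))"
    using local_rep_gradient_map[OF c v maps(2) rep] by blast
  obtain k' where k': "\<And>y. y \<in> local_dom c' c G \<Longrightarrow> local_rep c' c G y =
      (\<chi> i. k' i + (\<Sum>j\<in>UNIV. P j i * pderiv_at j (chart_pot c' \<circ> chart_inv c') y))"
    using dual.local_rep_gradient_map[OF c' w maps(1) rep'[unfolded img]] by blast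
  show ?thesis
  proof (rule pair[OF k k'])
    fix x assume "x \<in> local_dom c c' F"
    then obtain m where m: "m \<in> chart_dom c" "F m \<in> chart_dom c'" "x = chart_map c m"
      by (auto simp: local_dom_def)
    have GFm: "G (F m) = m" using GF dc m by blast
    have x: "local_rep c c' F x = chart_map c' (F m)"
      using chart_at_inv[OF v m(1)] by (simp add: local_rep_def m(3))
    moreover have "chart_map c' (F m) \<in> local_dom c' c G"
      unfolding local_dom_def using m GFm by (intro imageI) auto
    moreover have "local_rep c' c G (chart_map c' (F m)) = x"
      using dual.chart_at_inv[OF w m(2)] by (simp add: local_rep_def m(3) GFm)
    ultimately show "local_rep c c' F x \<in> local_dom c' c G \<and> local_rep c' c G (local_rep c c' F x) = x"
      by simp
  qed
qed

lemma local_potential: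
  assumes "c \<in> atlas"
  shows "smooth_on (local_dom c c' F) (chart_pot c \<circ> chart_inv c)"
    and "x \<in> local_dom c c' F \<Longrightarrow> pos_def (hessian (chart_pot c \<circ> chart_inv c) x)"
proof -
  have "local_dom c c' F \<subseteq> chart_map c ` chart_dom c" by (auto simp: local_dom_def)
  then show "smooth_on (local_dom c c' F) (chart_pot c \<circ> chart_inv c)"
    "x \<in> local_dom c c' F \<Longrightarrow> pos_def (hessian (chart_pot c \<circ> chart_inv c) x)"
    using atlas_smooth[OF assms] smooth_on_subset by blast+
qed

lemma smooth_local_rep:
  assumes c: "c \<in> atlas" and c': "c' \<in> induced_atlas D' D \<Psi> \<Phi> b'"
  shows "smooth_on (local_dom c c' F) (local_rep c c' F)"
  using c c'
proof (cases rule: local_rep_pair)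
  case (pair k k' P)
  then show ?thesis using gradient_map_smooth[OF local_dom_open[OF c c'] local_potential(1)[OF c]] by blast
qed

text \<open>The map \<open>F\<close> exchanges the two kinds of pieces: open facets go to vertex
  domains of the dual side, and vertex domains to open facets.\<close>

lemma homeomorphism_domain:
  "homeomorphism domain (induced_domain D' D \<Psi> \<Phi>) F G"
proof -
  interpret dual: mirror D' D \<Psi> \<Phi> G F b' b by (rule mirror_swap)
  have 1: "F ` open_face D D' w = dual.vertex_dom w" if "w \<in> verts D'" for w
    unfolding dual.vertex_dom_def using open_face_subset_frontier[OF that] F_in GF FG by force
  have 2: "F ` vertex_dom v = open_face D' D v" if "v \<in> verts D" for v
  proof
    show "F ` vertex_dom v \<subseteq> open_face D' D v" by (auto simp: vertex_dom_def)
    show "open_face D' D v \<subseteq> F ` vertex_dom v"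
    proof
      fix n assume n: "n \<in> open_face D' D v"
      then have "n \<in> frontier D'" using dual.open_face_subset_frontier[OF that] by blast
      then show "n \<in> F ` vertex_dom v"
        using n FG G_in by (intro image_eqI[of _ _ "G n"]) (simp_all add: vertex_dom_def)
    qed
  qed
  have "F ` domain = dual.domain"
    unfolding domain_eq dual.domain_eq image_Un image_UN using 1 2 by auto
  then show ?thesis
    by (rule homeomorphism_of_subsets[OF homeo domain_subset_frontier dual.domain_subset_frontier])
qed

section \<open>The isomorphism with the dual\<close>

lemma dual_isomorphism:
  "affine_isomorphism domain atlas (dual_connection hess_metric flat_connection)
      (induced_domain D' D \<Psi> \<Phi>) (induced_atlas D' D \<Psi> \<Phi> b') flat_connection F"
  "preserves_metric atlas hess_metric (induced_atlas D' D \<Psi> \<Phi> b') hess_metric F"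
proof -
  interpret dual: mirror D' D \<Psi> \<Phi> G F b' b by (rule mirror_swap)
  have "diffeo_between domain atlas dual.domain dual.atlas F"
    unfolding diffeo_between_def
    using homeomorphism_domain smooth_local_rep dual.smooth_local_rep by blast
  moreover have "preserves_connection atlas (dual_connection hess_metric flat_connection)
      dual.atlas flat_connection F"
    unfolding preserves_connection_def Let_def
  proof (intro ballI allI)
    fix c c' x a j k assume c: "c \<in> atlas" and c': "c' \<in> dual.atlas" and x: "x \<in> local_dom c c' F"
    show "pderiv_at j (pderiv_at k (\<lambda>y. local_rep c c' F y $ a)) x +
        (\<Sum>p\<in>UNIV. \<Sum>q\<in>UNIV. flat_connection c' (local_rep c c' F x) a p q *
           pderiv_at j (\<lambda>y. local_rep c c' F y $ p) x * pderiv_at k (\<lambda>y. local_rep c c' F y $ q) x) =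
        (\<Sum>i\<in>UNIV. dual_connection hess_metric flat_connection c x i j k *
           pderiv_at i (\<lambda>y. local_rep c c' F y $ a) x)"
      using c c'
    proof (cases rule: local_rep_pair)
      case (pair k0 k' P)
      \<comment> \<open>The target symbols vanish in affine coordinates, so the transformation law
        reduces to the second derivative formula with symbols
        \<open>2 * levi_civita\<close>.\<close>
      show ?thesis
        using gradient_map_connection[OF local_dom_open[OF c c'] x local_potential(1)[OF c]
            local_potential(2)[OF c x] pair(1)]
        by (simp add: flat_connection_def dual_connection_def hess_metric_def)
    qed
  qed
  ultimately show "affine_isomorphism domain atlas (dual_connection hess_metric flat_connection)
      dual.domain dual.atlas flat_connection F"
    by (simp add: affine_isomorphism_def)
  show "preserves_metric atlas hess_metric dual.atlas hess_metric F"
    unfolding preserves_metric_def Let_def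
  proof (intro ballI allI)
    fix c c' x j k assume c: "c \<in> atlas" and c': "c' \<in> dual.atlas" and x: "x \<in> local_dom c c' F"
    show "hess_metric c x $ j $ k =
        (\<Sum>p\<in>UNIV. \<Sum>q\<in>UNIV. hess_metric c' (local_rep c c' F x) $ p $ q *
           pderiv_at j (\<lambda>y. local_rep c c' F y $ p) x * pderiv_at k (\<lambda>y. local_rep c c' F y $ q) x)"
      using c c'
    proof (cases rule: local_rep_pair)
      case (pair k0 k' P)
      show ?thesis
        unfolding hess_metric_def
        by (rule gradient_map_metric[OF local_dom_open[OF c c'] x local_potential(1)[OF c] pair(1)
              dual.local_dom_open[OF c' c] dual.local_potential(1)[OF c'] pair(2,3)])
    qed
  qed
qed

end

text \<open>By convexity the slope from \<open>m\<close> towards \<open>v\<close> over length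
  \<open>s\<close> is at most the slope over a larger length \<open>t\<close>. The latter is
  asymptotically at most 1, because \<Phi> is within \<open>C\<close> of the support function of
  \<open>D'\<close>, whose growth along \<open>v\<close> is at most \<open>t\<close>.\<close>

lemma convex_growth:
  fixes \<Phi> :: "'a::euclidean_space \<Rightarrow> real"
  assumes conv: "convex_on UNIV \<Phi>" and D': "D' \<noteq> {}" "\<And>m n. m \<in> D \<Longrightarrow> n \<in> D' \<Longrightarrow> m \<bullet> n \<le> 1"
    and bdd: "bounded D'" and C: "\<And>m. \<bar>(SUP n\<in>D'. m \<bullet> n) - \<Phi> m\<bar> \<le> C" and v: "v \<in> D" and s: "0 \<le> s"
  shows "\<Phi> (m + s *\<^sub>R v) \<le> \<Phi> m + s"
proof (cases "s = 0")
  case False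
  define h where "h = (SUP n\<in>D'. m \<bullet> n)"
  have bd: "bdd_above ((\<lambda>n. m \<bullet> n) ` D')" for m
    by (rule bounded_imp_bdd_above[OF bounded_linear_image[OF bdd bounded_linear_inner_right]])
  have up: "\<Phi> (m + t *\<^sub>R v) \<le> h + t + C" if "t \<ge> 0" for t
  proof -
    have "(SUP n\<in>D'. (m + t *\<^sub>R v) \<bullet> n) \<le> h + t"
    proof (rule cSUP_least[OF D'(1)])
      fix n assume n: "n \<in> D'"
      have "m \<bullet> n \<le> h" unfolding h_def by (rule cSUP_upper[OF n bd])
      moreover have "t * (v \<bullet> n) \<le> t * 1" using D'(2)[OF v n] that by (rule mult_left_mono)
      ultimately show "(m + t *\<^sub>R v) \<bullet> n \<le> h + t" by (simp add: inner_add_left)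
    qed
    then show ?thesis using C[of "m + t *\<^sub>R v"] by linarith
  qed
  have "\<Phi> (m + s *\<^sub>R v) \<le> \<Phi> m + s + (s / t) * (h + C - \<Phi> m)" if t: "t > s" for t
  proof -
    have t0: "t > 0" using s t by simp
    \<comment> \<open>The intermediate point has weight \<open>s / t\<close>, so the error in
      \<open>up\<close> is multiplied by a factor tending to 0.\<close>
    have "m + s *\<^sub>R v = (1 - s / t) *\<^sub>R m + (s / t) *\<^sub>R (m + t *\<^sub>R v)"
      using t0 by (simp add: algebra_simps)
    then have "\<Phi> (m + s *\<^sub>R v) \<le> (1 - s / t) * \<Phi> m + (s / t) * \<Phi> (m + t *\<^sub>R v)"
      using convex_onD[OF conv, of "s / t" m "m + t *\<^sub>R v"] s t by simp
    also have "\<dots> \<le> (1 - s / t) * \<Phi> m + (s / t) * (h + t + C)"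
      using up[of t] s t0 by (intro add_left_mono mult_left_mono) auto
    also have "\<dots> = \<Phi> m + s + (s / t) * (h + C - \<Phi> m)"
      using t0 by (simp add: field_simps)
    finally show ?thesis .
  qed
  then have "\<forall>\<^sub>F t in at_top. \<Phi> (m + s *\<^sub>R v) \<le> \<Phi> m + s + (s / t) * (h + C - \<Phi> m)"
    by (intro eventually_at_top_linorderI[of "s + 1"]) auto
  moreover have "((\<lambda>t. \<Phi> m + s + (s / t) * (h + C - \<Phi> m)) \<longlongrightarrow> \<Phi> m + s + 0 * (h + C - \<Phi> m)) at_top"
    by (intro tendsto_intros tendsto_divide_0[OF tendsto_const] filterlim_at_top_imp_at_infinity filterlim_ident)
  ultimately show ?thesis
    using tendsto_lowerbound[of "\<lambda>t. \<Phi> m + s + (s / t) * (h + C - \<Phi> m)" _ at_top] by fastforce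
qed simp

theorem theorem4p6:
  fixes M N \<Delta> \<Delta>' X Y :: "'a::euclidean_space set"
    and \<Phi> \<Psi> :: "'a \<Rightarrow> real"
    and b b' :: "'a set \<Rightarrow> 'd::finite \<Rightarrow> 'a"
    and A B :: "('a, 'd) hchart set"
  assumes dim: "DIM('a) = CARD('d) + 1"
    and lattice: "full_lattice M"
    and N: "N = dual_lattice M"
    and reflexive: "reflexive_polytope M \<Delta>"
    and \<Delta>': "\<Delta>' = dual_polytope \<Delta>"
    and convex: "convex_on UNIV \<Phi>"
    and bounded: "\<exists>C. \<forall>m. \<bar>(SUP n\<in>\<Delta>'. m \<bullet> n) - \<Phi> m\<bar> \<le> C"
    and \<Psi>: "\<Psi> = c_transform \<Delta> \<Phi>"
    and gens: "\<And>\<tau>. \<tau> facet_of \<Delta>' \<Longrightarrow>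
          generates_lattice (b \<tau>) (N \<inter> {n. facet_vertex \<Delta> \<tau> \<bullet> n = 0})"
    and gens': "\<And>\<sigma>. \<sigma> facet_of \<Delta> \<Longrightarrow>
          generates_lattice (b' \<sigma>) (M \<inter> {m. m \<bullet> facet_vertex \<Delta>' \<sigma> = 0})"
    and X: "X = induced_domain \<Delta> \<Delta>' \<Phi> \<Psi>"
    and A: "A = induced_atlas \<Delta> \<Delta>' \<Phi> \<Psi> b"
    and Y: "Y = induced_domain \<Delta>' \<Delta> \<Psi> \<Phi>"
    and B: "B = induced_atlas \<Delta>' \<Delta> \<Psi> \<Phi> b'"
    and smooth_\<Phi>: "smooth_potentials A"
    and smooth_\<Psi>: "smooth_potentials B"
    and homeo: "\<exists>F G. homeomorphism (frontier \<Delta>) (frontier \<Delta>') F G \<and>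
          (\<forall>m\<in>frontier \<Delta>. c_gradient \<Delta> \<Delta>' \<Phi> \<Psi> m = {F m})"
  shows "hessian_manifold X A \<and> hessian_manifold Y B \<and>
    (\<exists>F. affine_isomorphism X A (dual_connection hess_metric flat_connection)
                            Y B flat_connection F \<and>
         preserves_metric A hess_metric B hess_metric F)"
proof -
  interpret polar_pair \<Delta> \<Delta>' unfolding \<Delta>' by (rule reflexive_polar_pair[OF reflexive])
  note dual_facet = polar_pair.facet_iff[OF swap] and dual_vertex = polar_pair.facet_vertex_face_at[OF swap]
  obtain F G where FG: "homeomorphism (frontier \<Delta>) (frontier \<Delta>') F G"
    "\<And>m. m \<in> frontier \<Delta> \<Longrightarrow> c_gradient \<Delta> \<Delta>' \<Phi> \<Psi> m = {F m}" using homeo by blast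
  obtain C where C: "\<And>m. \<bar>(SUP n\<in>\<Delta>'. m \<bullet> n) - \<Phi> m\<bar> \<le> C" using bounded by blast
  have vM: "verts \<Delta> \<subseteq> M" "verts \<Delta>' \<subseteq> N"
    using reflexive verts_lattice_polytope unfolding reflexive_polytope_def \<Delta>' N by blast+
  have pairing: "m \<bullet> n \<in> \<int>" if "m \<in> M" "n \<in> N" for m n
    using that by (simp add: N dual_lattice_def)
  have frD: "frontier \<Delta> \<subseteq> \<Delta>" "compact (frontier \<Delta>)"
    using polytope_imp_compact[OF polytope(1)] compact_imp_closed frontier_subset_closed compact_frontier by blast+
  have frne: "frontier \<Delta> \<noteq> {}"
    using polytope_imp_bounded[OF polytope(1)] zero_in_interior interior_subset
    by (metis empty_iff frontier_eq_empty interior_empty not_bounded_UNIV)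
  have cont: "continuous_on S \<Phi>" for S
    using convex_on_continuous[OF open_UNIV convex] continuous_on_subset by blast
  \<comment> \<open>A finite convex function is continuous, so on the compact boundary the supremum
    defining \<Psi> is a genuine one.\<close>
  have bd: "bdd_above ((\<lambda>m. m \<bullet> n - \<Phi> m) ` frontier \<Delta>)" for n
    by (intro bounded_imp_bdd_above compact_imp_bounded compact_continuous_image frD(2))
       (intro continuous_intros cont)
  have \<Psi>_eq: "\<Psi> n = (SUP m\<in>frontier \<Delta>. m \<bullet> n - \<Phi> m)" for n by (simp add: \<Psi> c_transform_def)
  have duality: "m \<bullet> n \<le> \<Phi> m + \<Psi> n" if "m \<in> frontier \<Delta>" for m n
    using cSUP_upper[OF that bd[of n]] by (simp add: \<Psi>_eq)
  have 0: "0 \<in> \<Delta>'" using polar_pair.zero_in_interior[OF swap] interior_subset by blast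
  have pair: "m \<bullet> n \<le> 1" if "m \<in> \<Delta>" "n \<in> \<Delta>'" for m n using that mem_dual_iff(2) by blast
  interpret mirror \<Delta> \<Delta>' \<Phi> \<Psi> F G b b'
  proof
    show "m \<bullet> n \<le> \<Phi> m + \<Psi> n" if "m \<in> frontier \<Delta>" for m n by (rule duality[OF that])
    show "\<Phi> m + \<Psi> n = m \<bullet> n \<longleftrightarrow> n = F m" if "m \<in> frontier \<Delta>" "n \<in> frontier \<Delta>'" for m n
      using FG(2)[OF that(1)] that unfolding c_gradient_def by blast
    show "\<Phi> (m + s *\<^sub>R v) \<le> \<Phi> m + s" if "v \<in> \<Delta>" "0 \<le> s" for m v s
      by (rule convex_growth[OF convex _ pair polytope_imp_bounded[OF polytope(2)] C that]) (use 0 in blast)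
    \<comment> \<open>For \<Psi> the growth bound follows from the supremum: each competing affine
      function has a slope \<open>m\<close> in the polytope, and \<open>m \<bullet> w\<close> is at
      most 1.\<close>
    show "\<Psi> (n + s *\<^sub>R w) \<le> \<Psi> n + s" if w: "w \<in> \<Delta>'" and s: "0 \<le> s" for n w s
      unfolding \<Psi>_eq[of "n + s *\<^sub>R w"]
    proof (rule cSUP_least[OF frne])
      fix m assume m: "m \<in> frontier \<Delta>"
      have "s * (m \<bullet> w) \<le> s * 1" using pair[OF _ w] m frD(1) s by (intro mult_left_mono) auto
      then show "m \<bullet> (n + s *\<^sub>R w) - \<Phi> m \<le> \<Psi> n + s"
        using duality[OF m, of n] by (simp add: inner_add_right)
    qed
    show "perp_basis v (b (face_at \<Delta>' v))" if v: "v \<in> verts \<Delta>" for v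
    proof (rule generates_lattice_perp_basis[of N])
      show "generates_lattice (b (face_at \<Delta>' v)) (N \<inter> {n. v \<bullet> n = 0})"
        using gens[of "face_at \<Delta>' v"] dual_facet dual_vertex[OF v] v by auto
    qed (use v vM pairing vert_nonzero dual_lattice_int_closed dual_lattice_span[OF lattice] in \<open>auto simp: N\<close>)
    show "perp_basis w (b' (face_at \<Delta> w))" if w: "w \<in> verts \<Delta>'" for w
    proof (rule generates_lattice_perp_basis[of M])
      show "generates_lattice (b' (face_at \<Delta> w)) (M \<inter> {m. w \<bullet> m = 0})"
        using gens'[of "face_at \<Delta> w"] facet_iff facet_vertex_face_at[OF w] w by (auto simp: inner_commute)
      show "w \<bullet> m \<in> \<int>" if "m \<in> M" for m
        using pairing[OF that, of w] w vM by (auto simp: inner_commute[of w])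
    qed (use w polar_pair.vert_nonzero[OF swap] full_lattice_int_closed[OF lattice] full_lattice_span[OF lattice] in auto)
  qed (use dim FG(1) smooth_\<Phi> smooth_\<Psi> in \<open>auto simp: A B\<close>)
  show ?thesis
    unfolding X A Y B
    using hessian_manifold_atlas mirror.hessian_manifold_atlas[OF mirror_swap] dual_isomorphism by blast
qed

end
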